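(* Let $X=(X_n)_{n\in\mathbb{Z}}$ be the i.i.d. increments of a skip-free to the left random walk with $\mathbb{E}[X_0]=0$, and let $[\mathbb{Z},0,Y]$ be the network associated to the sequence of random variables $Y=(Y_n)_{n\in\mathbb{Z}}$ produced by the construction described in the context. Then $[\mathbb{Z},0,Y]$ is the $R$-probability of $[\mathbb{Z},0,X]$, where $R$ is the record vertex-shift.
   Context: **Increments.** "I.i.d. increments of a skip-free to the left random walk" means: $X=(X_n)_{n\in\mathbb{Z}}$ is i.i.d., each $X_n$ takes values in $\{-1,0,1,2,\dots\}$, $\mathbb{P}[X_0=-1]>0$ and $\mathbb{E}[X_0]<\infty$. **Networks and $R$-probability.** $[\mathbb{Z},i,x]$ denotes the equivalence class, up to translation, of the line $\mathbb{Z}$ rooted at $i$ with mark $x_n$ on the edge $(n,n+1)$; it is identified with the sequence $(x_{n+i})_{n\in\mathbb{Z}}$, and the local topology is the product topology on integer sequences. The record map is $R_x(i)=\inf\{j>i:\sum_{l=i}^{j-1}x_l\ge 0\}$ if the infimum exists and $R_x(i)=i$ otherwise. The $R$-probability of $[\mathbb{Z},0,X]$ is the weak limit as $n\to\infty$ of the distributions of $[\mathbb{Z},R_X^n(0),X]$. So the claim is that $(X_{k+R_X^n(0)})_{k\in\mathbb{Z}}$ converges in distribution to $(Y_k)_{k\in\mathbb{Z}}$. **Construction of $Y$.** Let $\lambda$ be the law of $X_0$, $\pi$ the law of $X_0+1$, and $\hat\pi(k)=k\pi(k)$ for $k\ge0$ (the size-biased distribution of $\pi$). The variables $(Y_n)_{n\ge0}$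 are i.i.d. with law $\lambda$. Independently, $(Y_n)_{n<0}$ is built by the following iteration, with fresh independent randomness at each pass: 1. Let $l=-1$. 2. Generate $Z$ with law $\hat\pi$ and set $Y_l:=Z-1$. 3. Choose $K$ uniformly in $\{0,1,\dots,Y_l\}$. 4. Generate an i.i.d. sequence $(Z_n)_{n<0}$ with law $\lambda$. 5. Let $\tau=\sup\{n<0: -Y_l-\sum_{m=n}^{-1}Z_m=-K\}$. Set $Y_{n+l}:=Z_n$ for $\tau\le n<0$. 6. Set $l:=l+\tau-1$. 7. Repeat from step 2.
   Formalization: In step 5 the supremum defining τ is taken over n ≤ 0 (empty sum 0) instead of n < 0, so τ = 0 when K = Y_l; with n < 0 the claim fails for every admissible law (simple symmetric walk: P[Y_{-2}=1] would be 1/2, while the limit gives 3/4). *)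

theory Defs
  imports "HOL-Probability.Probability"
begin

text \<open>
  A rooted line with integer marks, taken up to translation, is represented by its sequence of
  marks read from the root. Its local topology is then the product topology on
  \<^typ>\<open>int \<Rightarrow> int\<close>, with \<^typ>\<open>int\<close> discrete, which is the library topology of this type.
\<close>

definition rooted_line :: "int \<Rightarrow> (int \<Rightarrow> int) \<Rightarrow> (int \<Rightarrow> int)" where
  "rooted_line i x = (\<lambda>n. x (n + i))"

definition record_map :: "(int \<Rightarrow> int) \<Rightarrow> int \<Rightarrow> int" where
  "record_map x i =
     (if \<exists>j>i. (\<Sum>l = i..j - 1. x l) \<ge> 0
      then Inf {j. j > i \<and> (\<Sum>l = i..j - 1. x l) \<ge> 0}
      else i)"

text \<open>
  The library only has weak convergence of measures on the reals. The arguments below are meant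
  to be probability measures on the Borel sets.
\<close>

definition weakly_converges ::
    "(nat \<Rightarrow> 'a::topological_space measure) \<Rightarrow> 'a measure \<Rightarrow> bool" where
  "weakly_converges P Q \<longleftrightarrow>
     (\<forall>f :: 'a \<Rightarrow> real. continuous_on UNIV f \<longrightarrow> bounded (range f) \<longrightarrow>
        (\<lambda>n. \<integral>x. f x \<partial>P n) \<longlonglongrightarrow> (\<integral>x. f x \<partial>Q))"

text \<open>
  For a vertex-shift \<open>F\<close>, the measure \<open>Q\<close> is the \<open>F\<close>-probability of the line rooted at \<open>0\<close> with
  random marks \<open>X\<close>.
\<close>

definition is_vertex_shift_probability ::
    "((int \<Rightarrow> int) \<Rightarrow> int \<Rightarrow> int) \<Rightarrow> 'a measure \<Rightarrow> ('a \<Rightarrow> int \<Rightarrow> int) \<Rightarrow>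
     (int \<Rightarrow> int) measure \<Rightarrow> bool" where
  "is_vertex_shift_probability F M X Q \<longleftrightarrow>
     weakly_converges
       (\<lambda>n. distr M borel (\<lambda>\<omega>. rooted_line ((F (X \<omega>) ^^ n) 0) (X \<omega>))) Q"

text \<open>As the increments are bounded below by \<open>-1\<close>, a finite mean amounts to integrability.\<close>

definition skip_free_left_increments :: "'a measure \<Rightarrow> (int \<Rightarrow> 'a \<Rightarrow> int) \<Rightarrow> bool" where
  "skip_free_left_increments M X \<longleftrightarrow>
     prob_space M \<and>
     prob_space.indep_vars M (\<lambda>_. count_space UNIV) X UNIV \<and>
     (\<forall>n. distr M (count_space UNIV) (X n) = distr M (count_space UNIV) (X 0)) \<and>
     (\<forall>n. AE \<omega> in M. X n \<omega> \<ge> -1) \<and>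
     measure M {\<omega> \<in> space M. X 0 \<omega> = -1} > 0 \<and>
     integrable M (\<lambda>\<omega>. real_of_int (X 0 \<omega>))"

definition offspring_pmf :: "int pmf \<Rightarrow> int pmf" where
  "offspring_pmf lam = map_pmf (\<lambda>x. x + 1) lam"

text \<open>
  The weights below have total mass one exactly when the offspring distribution has mean one,
  that is, when \<open>lam\<close> has mean zero.
\<close>

definition size_biased_pmf :: "int pmf \<Rightarrow> int pmf" where
  "size_biased_pmf lam =
     embed_pmf (\<lambda>k. if k \<ge> 0 then real_of_int k * pmf (offspring_pmf lam) k else 0)"

text \<open>
  The joint law of \<open>(Z, K)\<close> in one pass of the construction: \<open>K\<close> is uniform on
  \<open>{0..Z - 1}\<close> given \<open>Z\<close>. This set is nonempty almost surely, since the size-biased law does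
  not charge \<open>0\<close>.
\<close>

definition pass_pmf :: "int pmf \<Rightarrow> (int \<times> int) pmf" where
  "pass_pmf lam =
     bind_pmf (size_biased_pmf lam) (\<lambda>z. map_pmf (\<lambda>k. (z, k)) (pmf_of_set {0..z - 1}))"

text \<open>
  The independent randomness used by the construction: the values at nonnegative indices, and
  for each pass a pair \<open>(Z, K)\<close> with an independent i.i.d. sequence indexed by the negative
  integers.
\<close>

type_synonym pass_input = "(int \<times> int) \<times> (int \<Rightarrow> int)"

definition construction_space :: "int pmf \<Rightarrow> ((int \<Rightarrow> int) \<times> (nat \<Rightarrow> pass_input)) measure" where
  "construction_space lam =
     (\<Pi>\<^sub>M n\<in>{0..}. measure_pmf lam) \<Otimes>\<^sub>M
     (\<Pi>\<^sub>M j\<in>UNIV. measure_pmf (pass_pmf lam) \<Otimes>\<^sub>M (\<Pi>\<^sub>M n\<in>{..<0}. measure_pmf lam))"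

text \<open>
  The supremum includes \<open>n = 0\<close> (with the empty sum): it is attained there exactly when
  \<open>k = yl\<close>, and then the pass sets only the value at \<open>l\<close>. Requiring \<open>n < 0\<close> would replace \<open>0\<close>
  by the first return time to \<open>0\<close> of the reversed walk when \<open>k = yl\<close>, and the sequence constructed would not
  have the limiting law: for the simple symmetric walk the value at \<open>-2\<close> is \<open>1\<close> with
  probability \<open>3/4\<close> in the limit, but would be \<open>1\<close> with probability \<open>1/2\<close> in the construction.
\<close>

definition pass_time :: "int \<Rightarrow> int \<Rightarrow> (int \<Rightarrow> int) \<Rightarrow> int" where
  "pass_time yl k z = Sup {n. n \<le> 0 \<and> - yl - (\<Sum>m = n..-1. z m) = - k}"

text \<open>One pass, acting on the current index \<open>l\<close> and the current contents \<open>y\<close> of the sequence.\<close>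

fun run_pass :: "pass_input \<Rightarrow> int \<times> (int \<Rightarrow> int) \<Rightarrow> int \<times> (int \<Rightarrow> int)" where
  "run_pass ((z0, k), z) (l, y) =
     (let yl = z0 - 1; t = pass_time yl k z
      in (l + t - 1,
          \<lambda>i. if i = l then yl else if l + t \<le> i \<and> i < l then z (i - l) else y i))"

primrec run_passes ::
    "(nat \<Rightarrow> pass_input) \<Rightarrow> (int \<Rightarrow> int) \<Rightarrow> nat \<Rightarrow> int \<times> (int \<Rightarrow> int)" where
  "run_passes p y 0 = (-1, y)"
| "run_passes p y (Suc j) = run_pass (p j) (run_passes p y j)"

text \<open>
  Almost surely each pass lowers the current index by at least one, so for \<open>i < 0\<close> the value at \<open>i\<close> is final
  after \<open>- i\<close> passes; for \<open>i \<ge> 0\<close> it is the initial one.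
\<close>

definition constructed_seq :: "(int \<Rightarrow> int) \<times> (nat \<Rightarrow> pass_input) \<Rightarrow> int \<Rightarrow> int" where
  "constructed_seq \<omega> i = snd (run_passes (snd \<omega>) (fst \<omega>) (nat (- i))) i"

end

theory Submission
  imports Defs
begin

text \<open>
  The walk has mean zero, so the record map always finds a later record, and its iterates at the
  root are the successive weak ascending ladder times. Call \<open>b\<close> a ladder word if its proper
  nonempty prefixes have negative sum and its total is nonnegative. Each record step inserts a
  ladder word to the left of the root, and a given word \<open>b\<close> occurs with probability
  \<open>\<Prod> lam b\<^sub>i\<close>; after it the walk starts afresh.

  One pass of the construction writes a ladder word with exactly the same probabilities: for the
  last letter \<open>v\<close> the size-biasing factor \<open>v + 1\<close> cancels the uniform choice of \<open>K\<close> among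
  \<open>v + 1\<close> values, \<open>K\<close> is the total of the word, and the letters before \<open>v\<close>, read backwards,
  are the path of the walk until it first reaches \<open>K - v\<close>. This level is reached almost surely
  because a mean-zero skip-free walk descends to every negative level.

  Hence running \<open>n\<close> passes on a line that already carries i.i.d. values gives exactly the law of
  the line seen from its \<open>n\<close>-th record. In this coupling every coordinate is eventually constant
  in \<open>n\<close>, with the constructed sequence as the limit, and dominated convergence gives the weak limit.
\<close>

section \<open>Descent of a mean-zero skip-free walk\<close>

text \<open>Strictness makes the tangent bound in \<open>descent_prob_1\<close> informative:
  equality is then possible only for the exponents 0 and 1. The induction multiplies a strict
  inequality by \<open>q\<close>, so \<open>q = 0\<close> is split off.\<close>

lemma bernoulli_strict:
  fixes q :: real
  assumes "0 \<le> q" "q < 1" "2 \<le> k"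
  shows "1 + real k * (q - 1) < q ^ k"
  using assms(3)
proof (induction k rule: dec_induct)
  case base
  have "0 < (q - 1)\<^sup>2" using assms by simp
  then show ?case by (simp add: power2_eq_square algebra_simps)
next
  case (step k)
  have "1 + real (Suc k) * (q - 1) \<le> q * (1 + real k * (q - 1))"
  proof -
    have "0 \<le> real k * (q - 1)\<^sup>2" by simp
    then show ?thesis by (simp add: power2_eq_square algebra_simps)
  qed
  also have "\<dots> < q ^ Suc k" if "q \<noteq> 0"
    using step that assms by (simp add: mult_strict_left_mono)
  finally show ?case
    using step assms by (cases "q = 0") (auto simp: algebra_simps)
qed

lemma measurable_sum_int [measurable]:
  fixes f :: "'i \<Rightarrow> 'a \<Rightarrow> int"
  assumes "\<And>i. i \<in> I \<Longrightarrow> f i \<in> M \<rightarrow>\<^sub>M count_space UNIV"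
  shows "(\<lambda>x. \<Sum>i\<in>I. f i x) \<in> M \<rightarrow>\<^sub>M count_space UNIV"
  using assms
proof (induction I rule: infinite_finite_induct)
  case (insert i I)
  then have [measurable]: "f i \<in> M \<rightarrow>\<^sub>M count_space UNIV"
    "(\<lambda>x. \<Sum>i\<in>I. f i x) \<in> M \<rightarrow>\<^sub>M count_space UNIV" by auto
  have "(\<lambda>x. f i x + (\<Sum>i\<in>I. f i x)) \<in> M \<rightarrow>\<^sub>M count_space UNIV"
    by (rule measurable_compose_countable[where g = "f i" and f = "\<lambda>j x. j + (\<Sum>i\<in>I. f i x)"]) measurable
  then show ?case using insert by simp
qed auto

locale mean_zero_skip_free =
  fixes lam :: "int pmf"
  assumes ge_minus_one: "x \<in> set_pmf lam \<Longrightarrow> -1 \<le> x"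
    and minus_one_pos: "-1 \<in> set_pmf lam"
    and integrable_id: "integrable (measure_pmf lam) real_of_int"
    and mean_zero: "(\<integral>x. real_of_int x \<partial>measure_pmf lam) = 0"
begin

definition walk_measure :: "(nat \<Rightarrow> int) measure" where
  "walk_measure = (\<Pi>\<^sub>M n\<in>UNIV. measure_pmf lam)"

text \<open>The predicate \<open>Q\<close> restricts the admissible times. One first-step equation
  then serves both the unrestricted event and the time-bounded one, on which induction is
  possible.\<close>

definition hits :: "(nat \<Rightarrow> bool) \<Rightarrow> int \<Rightarrow> (nat \<Rightarrow> int) set" where
  "hits Q a = {z. \<exists>n. Q n \<and> (\<Sum>i<n. z i) = - a}"

lemma space_walk_measure [simp]: "space walk_measure = UNIV"
  by (simp add: walk_measure_def space_PiM)

sublocale walk: prob_space walk_measure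
  unfolding walk_measure_def by (rule prob_space_PiM) (rule measure_pmf.prob_space_axioms)

lemma measurable_walk_component [measurable]: "(\<lambda>z. z i) \<in> walk_measure \<rightarrow>\<^sub>M count_space UNIV"
  unfolding walk_measure_def
  by (rule measurable_compose[OF measurable_component_singleton[of i]]) auto

lemma sets_hits [measurable]: "hits Q a \<in> sets walk_measure"
proof -
  have "hits Q a = {z \<in> space walk_measure. \<exists>n. Q n \<and> (\<Sum>i<n. z i) = - a}"
    by (simp add: hits_def)
  also have "\<dots> \<in> sets walk_measure"
    by (rule sets.sets_Collect_countable_Ex) measurable
  finally show ?thesis .
qed

lemma walk_measure_peel:
  "distr (measure_pmf lam \<Otimes>\<^sub>M walk_measure) walk_measure (\<lambda>(x, z). case_nat x z) = walk_measure"
proof -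
  interpret sequence_space "measure_pmf lam" ..
  show ?thesis using PiM_iter unfolding walk_measure_def .
qed

text \<open>After a first step \<open>x\<close> the fresh walk has to reach
  \<open>- (a + x)\<close>; one unit of time is used up, whence the shift of
  \<open>Q\<close>.\<close>

lemma emeasure_hits_first_step:
  assumes "a \<noteq> 0"
  shows "emeasure walk_measure (hits Q a) =
    (\<integral>\<^sup>+x. emeasure walk_measure (hits (\<lambda>n. Q (Suc n)) (a + x)) \<partial>measure_pmf lam)"
proof -
  have meas [measurable]: "(\<lambda>(x, z). case_nat x z) \<in> measure_pmf lam \<Otimes>\<^sub>M walk_measure \<rightarrow>\<^sub>M walk_measure"
    unfolding walk_measure_def by measurable
  have eq: "case_nat x z \<in> hits Q a \<longleftrightarrow> z \<in> hits (\<lambda>n. Q (Suc n)) (a + x)" for x z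
  proof -
    have *: "(\<Sum>i<Suc n. case_nat x z i) = x + (\<Sum>i<n. z i)" for n
      by (subst sum.lessThan_Suc_shift) simp
    have "case_nat x z \<in> hits Q a \<longleftrightarrow> (\<exists>n. Q (Suc n) \<and> (\<Sum>i<Suc n. case_nat x z i) = - a)"
    proof
      assume "case_nat x z \<in> hits Q a"
      then obtain n where n: "Q n" "(\<Sum>i<n. case_nat x z i) = - a" by (auto simp: hits_def)
      \<comment> \<open>Time 0 is excluded: the empty sum is 0 and \<open>a\<close> is not.\<close>
      with assms obtain m where "n = Suc m" by (cases n) auto
      with n show "\<exists>n. Q (Suc n) \<and> (\<Sum>i<Suc n. case_nat x z i) = - a" by blast
    qed (auto simp: hits_def)
    also have "\<dots> \<longleftrightarrow> z \<in> hits (\<lambda>n. Q (Suc n)) (a + x)"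
      unfolding hits_def * by (auto simp: algebra_simps)
    finally show ?thesis .
  qed
  have "emeasure walk_measure (hits Q a) =
      emeasure (distr (measure_pmf lam \<Otimes>\<^sub>M walk_measure) walk_measure (\<lambda>(x, z). case_nat x z)) (hits Q a)"
    by (simp only: walk_measure_peel)
  also have "\<dots> = emeasure (measure_pmf lam \<Otimes>\<^sub>M walk_measure)
      ((\<lambda>(x, z). case_nat x z) -` hits Q a \<inter> space (measure_pmf lam \<Otimes>\<^sub>M walk_measure))"
    by (rule emeasure_distr) (use meas in auto)
  also have "\<dots> = (\<integral>\<^sup>+x. emeasure walk_measure (Pair x -` ((\<lambda>(x, z). case_nat x z) -` hits Q a \<inter>
      space (measure_pmf lam \<Otimes>\<^sub>M walk_measure))) \<partial>measure_pmf lam)"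
    by (rule walk.emeasure_pair_measure_alt) (use measurable_sets[OF meas sets_hits] in auto)
  also have "\<dots> = (\<integral>\<^sup>+x. emeasure walk_measure (hits (\<lambda>n. Q (Suc n)) (a + x)) \<partial>measure_pmf lam)"
    by (intro nn_integral_cong arg_cong2[where f = emeasure])
       (auto simp: space_pair_measure eq)
  finally show ?thesis .
qed

lemma hits_zero: "Q 0 \<Longrightarrow> hits Q 0 = UNIV"
  by (auto simp: hits_def intro!: exI[of _ 0])

text \<open>To reach \<open>- (a + b)\<close> it suffices to reach \<open>- a\<close> and then to descend by a further \<open>b\<close>.\<close>

lemma emeasure_hits_add:
  assumes "0 \<le> a" "0 \<le> b"
  shows "emeasure walk_measure (hits (\<lambda>n. n \<le> N) a) * emeasure walk_measure (hits (\<lambda>_. True) b)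
    \<le> emeasure walk_measure (hits (\<lambda>_. True) (a + b))"
  using assms(1)
\<comment> \<open>Induction on the time bound, with the first-step equation on both sides, takes the
  place of the strong Markov property.\<close>
proof (induction N arbitrary: a)
  case 0
  show ?case
  proof (cases "a = 0")
    case True
    then show ?thesis by (simp add: hits_zero walk.emeasure_space_1[simplified])
  next
    case False
    then have "hits (\<lambda>n. n \<le> 0) a = {}" by (auto simp: hits_def)
    then show ?thesis by simp
  qed
next
  case (Suc N)
  show ?case
  proof (cases "a = 0")
    case True
    then show ?thesis by (simp add: hits_zero walk.emeasure_space_1[simplified])
  next
    case False
    let ?h = "\<lambda>a. emeasure walk_measure (hits (\<lambda>_. True) a)"
    let ?hN = "\<lambda>a. emeasure walk_measure (hits (\<lambda>n. n \<le> N) a)"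
    have "emeasure walk_measure (hits (\<lambda>n. n \<le> Suc N) a) * ?h b =
        (\<integral>\<^sup>+x. ?hN (a + x) * ?h b \<partial>measure_pmf lam)"
      using False by (simp add: emeasure_hits_first_step nn_integral_multc)
    also have "\<dots> \<le> (\<integral>\<^sup>+x. ?h (a + b + x) \<partial>measure_pmf lam)"
    proof (intro nn_integral_mono_AE AE_pmfI)
      fix x assume "x \<in> set_pmf lam"
      \<comment> \<open>Skip-freeness enters here: a step reduces the remaining depth
        \<open>a > 0\<close> by at most one, so the new depth is nonnegative and the induction
        hypothesis applies.\<close>
      then have "0 \<le> a + x" using ge_minus_one[of x] False Suc.prems by simp
      from Suc.IH[OF this] show "?hN (a + x) * ?h b \<le> ?h (a + b + x)"
        by (simp add: ac_simps)
    qed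
    also have "\<dots> = ?h (a + b)"
      using False Suc.prems assms(2) by (subst (2) emeasure_hits_first_step) auto
    finally show ?thesis .
  qed
qed

definition descent_prob :: "int \<Rightarrow> real" where
  "descent_prob a = measure walk_measure (hits (\<lambda>_. True) a)"

text \<open>Continuity from below removes the time bound from
  \<open>emeasure_hits_add\<close>.\<close>

lemma descent_prob_add:
  assumes "0 \<le> a" "0 \<le> b"
  shows "descent_prob a * descent_prob b \<le> descent_prob (a + b)"
proof -
  have "incseq (\<lambda>N. hits (\<lambda>n. n \<le> N) a)"
    unfolding incseq_def hits_def by (blast intro: order_trans)
  moreover have "(\<Union>N. hits (\<lambda>n. n \<le> N) a) = hits (\<lambda>_. True) a"
    by (force simp: hits_def)
  ultimately have "(\<lambda>N. measure walk_measure (hits (\<lambda>n. n \<le> N) a)) \<longlonglongrightarrow> descent_prob a"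
    using walk.finite_Lim_measure_incseq[of "\<lambda>N. hits (\<lambda>n. n \<le> N) a"] by (auto simp: descent_prob_def image_subset_iff)
  then have "(\<lambda>N. measure walk_measure (hits (\<lambda>n. n \<le> N) a) * descent_prob b)
      \<longlonglongrightarrow> descent_prob a * descent_prob b"
    by (intro tendsto_intros)
  moreover have "measure walk_measure (hits (\<lambda>n. n \<le> N) a) * descent_prob b \<le> descent_prob (a + b)" for N
    using emeasure_hits_add[OF assms, of N]
    by (simp add: descent_prob_def walk.emeasure_eq_measure flip: ennreal_mult)
  ultimately show ?thesis
    by (intro LIMSEQ_le_const2) auto
qed

lemma descent_prob_0: "descent_prob 0 = 1"
  using walk.prob_space by (simp add: descent_prob_def hits_zero)

lemma descent_prob_nonneg: "0 \<le> descent_prob a"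
  by (simp add: descent_prob_def)

lemma descent_prob_le_1: "descent_prob a \<le> 1"
  by (simp add: descent_prob_def)

lemma descent_prob_power: "descent_prob 1 ^ n \<le> descent_prob (int n)"
proof (induction n)
  case 0
  then show ?case by (simp add: descent_prob_0)
next
  case (Suc n)
  have "descent_prob 1 ^ Suc n \<le> descent_prob 1 * descent_prob (int n)"
    using Suc by (simp add: mult_left_mono descent_prob_nonneg)
  also have "\<dots> \<le> descent_prob (1 + int n)"
    by (rule descent_prob_add) auto
  finally show ?case by simp
qed

lemma descent_prob_1_fixpoint:
  "(\<integral>x. descent_prob (1 + x) \<partial>measure_pmf lam) = descent_prob 1"
proof -
  have "ennreal (descent_prob 1) = (\<integral>\<^sup>+x. ennreal (descent_prob (1 + x)) \<partial>measure_pmf lam)"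
    using emeasure_hits_first_step[of 1 "\<lambda>_. True"]
    by (simp add: descent_prob_def walk.emeasure_eq_measure)
  then have "(\<integral>\<^sup>+x. ennreal (descent_prob (1 + x)) \<partial>measure_pmf lam) = ennreal (descent_prob 1)" ..
  then show ?thesis
    by (subst integral_eq_nn_integral) (auto simp: descent_prob_nonneg)
qed

text \<open>
  The generating function \<open>q \<mapsto> \<integral> q ^ (1 + x)\<close> lies above its tangent at \<open>1\<close>, which is the diagonal
  because the mean is zero. As \<open>descent_prob 1\<close> is at least the value of this function at
  \<open>descent_prob 1\<close>, it is \<open>1\<close>.
\<close>

lemma descent_prob_1: "descent_prob 1 = 1"
proof (rule ccontr)
  define q where "q = descent_prob 1"
  assume "descent_prob 1 \<noteq> 1"
  then have q: "0 \<le> q" "q < 1"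
    using descent_prob_nonneg[of 1] descent_prob_le_1[of 1] by (auto simp: q_def)
  \<comment> \<open>\<open>g\<close> is the gap between the power and its tangent at 1. The cut-off
    by \<open>nat\<close> is harmless, since \<open>1 + x\<close> is nonnegative on the
    support.\<close>
  define g where "g x = q ^ nat (1 + x) - (1 + real (nat (1 + x)) * (q - 1))" for x :: int
  have g_nonneg: "0 \<le> g x" for x
    using Bernoulli_inequality[of "q - 1" "nat (1 + x)"] q by (simp add: g_def)
  have int_pow: "integrable (measure_pmf lam) (\<lambda>x. q ^ nat (1 + x))"
    using q by (intro measure_pmf.integrable_const_bound[of _ 1]) (auto simp: power_le_one)
  have AE_eq: "AE x in measure_pmf lam. real (nat (1 + x)) = 1 + real_of_int x"
    using ge_minus_one by (intro AE_pmfI) force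
  have int_nat: "integrable (measure_pmf lam) (\<lambda>x. real (nat (1 + x)))"
    using integrable_id by (subst integrable_cong_AE[OF _ _ AE_eq]) auto
  have mean_nat: "(\<integral>x. real (nat (1 + x)) \<partial>measure_pmf lam) = 1"
    using integrable_id mean_zero by (subst integral_cong_AE[OF _ _ AE_eq]) auto
  have int_g: "integrable (measure_pmf lam) g"
    unfolding g_def using int_pow int_nat by auto
  have "(\<integral>x. q ^ nat (1 + x) \<partial>measure_pmf lam) \<le> (\<integral>x. descent_prob (1 + x) \<partial>measure_pmf lam)"
  proof (intro integral_mono_AE int_pow AE_pmfI)
    show "integrable (measure_pmf lam) (\<lambda>x. descent_prob (1 + x))"
      by (intro measure_pmf.integrable_const_bound[of _ 1])
         (auto simp: descent_prob_nonneg descent_prob_le_1)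
    fix x assume "x \<in> set_pmf lam"
    then show "q ^ nat (1 + x) \<le> descent_prob (1 + x)"
      using descent_prob_power[of "nat (1 + x)"] ge_minus_one[of x] by (simp add: q_def)
  qed
  \<comment> \<open>The tangent has mean \<open>1 + (q - 1) = q\<close>, and the power has mean at
    most \<open>q\<close> by the fixpoint equation.\<close>
  then have "(\<integral>x. g x \<partial>measure_pmf lam) \<le> 0"
    unfolding g_def using int_pow int_nat mean_nat descent_prob_1_fixpoint
    by (simp add: q_def)
  then have "(\<integral>x. g x \<partial>measure_pmf lam) = 0"
    by (intro antisym Bochner_Integration.integral_nonneg g_nonneg)
  then have "AE x in measure_pmf lam. g x = 0"
    using int_g g_nonneg by (subst (asm) integral_nonneg_eq_0_iff_AE) auto
  \<comment> \<open>Equality in the tangent bound leaves only exponents 0 and 1, so \<open>x\<close>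
    is never positive. With mean zero it vanishes almost surely, against the mass at
    \<open>-1\<close>.\<close>
  then have "AE x in measure_pmf lam. real_of_int x \<le> 0"
  proof eventually_elim
    case (elim x)
    show ?case
    proof (rule ccontr)
      assume "\<not> real_of_int x \<le> 0"
      then have "2 \<le> nat (1 + x)" by simp
      from bernoulli_strict[OF q this] elim show False by (simp add: g_def)
    qed
  qed
  then have "AE x in measure_pmf lam. - real_of_int x = 0"
    using integrable_id mean_zero
    by (subst integral_nonneg_eq_0_iff_AE[symmetric]) auto
  then show False
    using minus_one_pos by (auto simp: AE_measure_pmf_iff)
qed

lemma descent_prob_eq_1: "0 \<le> a \<Longrightarrow> descent_prob a = 1"
  using descent_prob_power[of "nat a"] descent_prob_le_1[of a] by (simp add: descent_prob_1)

lemma AE_walk_descends: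
  assumes "0 \<le> a"
  shows "AE z in walk_measure. \<exists>n. (\<Sum>i<n. z i) = - a"
proof -
  have "AE z in walk_measure. z \<in> hits (\<lambda>_. True) a"
    using descent_prob_eq_1[OF assms] by (subst walk.prob_eq_1[symmetric]) (auto simp: descent_prob_def)
  then show ?thesis by (auto simp: hits_def)
qed

end

section \<open>Ladder words and the block written by a pass\<close>

definition ladder :: "int list \<Rightarrow> bool" where
  "ladder b \<longleftrightarrow> b \<noteq> [] \<and> (\<forall>n. 0 < n \<longrightarrow> n < length b \<longrightarrow> sum_list (take n b) < 0) \<and> 0 \<le> sum_list b"

text \<open>The letters are listed from left to right along the line, so the value at the current
  index, which is generated first, comes last.\<close>

definition pass_block :: "pass_input \<Rightarrow> int list" where
  "pass_block q = map (snd q) [pass_time (fst (fst q) - 1) (snd (fst q)) (snd q)..-1] @ [fst (fst q) - 1]"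

text \<open>The level sought by the pass is reached, so the supremum in \<open>pass_time\<close>
  runs over a nonempty set.\<close>

definition pass_ok :: "pass_input \<Rightarrow> bool" where
  "pass_ok q \<longleftrightarrow> (\<exists>n\<le>0. - (fst (fst q) - 1) - (\<Sum>m = n..-1. snd q m) = - snd (fst q))"

text \<open>A nonempty set of integers bounded above by 0 has a largest element, found here through
  a least natural number. The supremum is therefore attained, and no time closer to 0 reaches the
  level.\<close>

lemma pass_time_props:
  assumes "n \<le> 0" "- y - (\<Sum>m = n..-1. z m) = - k"
  shows "pass_time y k z \<le> 0" "- y - (\<Sum>m = pass_time y k z..-1. z m) = - k"
    and "\<And>n. pass_time y k z < n \<Longrightarrow> n \<le> 0 \<Longrightarrow> - y - (\<Sum>m = n..-1. z m) \<noteq> - k"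
proof -
  define A where "A = {n. n \<le> 0 \<and> - y - (\<Sum>m = n..-1. z m) = - k}"
  define j where "j = (LEAST j. - int j \<in> A)"
  have "- int (nat (- n)) \<in> A" using assms by (simp add: A_def)
  then have j: "- int j \<in> A" unfolding j_def by (rule LeastI)
  have le: "n \<le> - int j" if "n \<in> A" for n
  proof -
    have "- int (nat (- n)) \<in> A" using that by (simp add: A_def)
    then have "j \<le> nat (- n)" unfolding j_def by (rule Least_le)
    with that show ?thesis by (auto simp: A_def le_nat_iff)
  qed
  have "pass_time y k z = - int j"
    unfolding pass_time_def A_def[symmetric] using j le by (rule cSup_eq_maximum)
  with j le show "pass_time y k z \<le> 0" "- y - (\<Sum>m = pass_time y k z..-1. z m) = - k"
    and "\<And>n. pass_time y k z < n \<Longrightarrow> n \<le> 0 \<Longrightarrow> - y - (\<Sum>m = n..-1. z m) \<noteq> - k"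
    by (force simp: A_def)+
qed

lemma sum_list_map_upto:
  fixes f :: "int \<Rightarrow> int"
  shows "sum_list (map f [i..j]) = (\<Sum>m = i..j. f m)"
  by (simp add: interv_sum_list_conv_sum_set_int)

lemma take_upto: "int n \<le> j - i + 1 \<Longrightarrow> take n [i..j] = [i..i + int n - 1]"
  by (rule nth_equalityI) auto

lemma sum_split_int:
  fixes f :: "int \<Rightarrow> int"
  assumes "i \<le> n" "n \<le> j + 1"
  shows "(\<Sum>m = i..j. f m) = (\<Sum>m = i..n - 1. f m) + (\<Sum>m = n..j. f m)"
proof -
  have "{i..j} = {i..n - 1} \<union> {n..j}" using assms by auto
  then show ?thesis by (simp add: sum.union_disjoint)
qed

lemma take_block:
  fixes z :: "int \<Rightarrow> int"
  assumes "0 < n" "n < length (map z [t..-1] @ [v])" "t \<le> 0"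
  shows "sum_list (take n (map z [t..-1] @ [v])) = (\<Sum>m = t..t + int n - 1. z m)"
  using assms by (simp add: take_map take_upto sum_list_map_upto)

text \<open>Bridge between prefixes of lists, in which \<open>ladder\<close> is phrased, and sums
  over integer intervals, in which \<open>pass_time\<close> is phrased.\<close>

lemma ladder_block_iff:
  fixes z :: "int \<Rightarrow> int"
  assumes "t \<le> 0"
  shows "ladder (map z [t..-1] @ [v]) \<longleftrightarrow>
    (\<forall>n. t < n \<and> n \<le> 0 \<longrightarrow> (\<Sum>m = t..n - 1. z m) < 0) \<and> 0 \<le> (\<Sum>m = t..-1. z m) + v"
proof -
  have "(\<forall>n. 0 < n \<longrightarrow> n < length (map z [t..-1] @ [v]) \<longrightarrow> sum_list (take n (map z [t..-1] @ [v])) < 0) \<longleftrightarrow>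
    (\<forall>n. 0 < n \<longrightarrow> n < length (map z [t..-1] @ [v]) \<longrightarrow> (\<Sum>m = t..t + int n - 1. z m) < 0)"
    using assms by (intro all_cong1 imp_cong refl) (simp only: take_block)
  also have "\<dots> \<longleftrightarrow> (\<forall>n. t < n \<and> n \<le> 0 \<longrightarrow> (\<Sum>m = t..n - 1. z m) < 0)"
  proof (intro iffI allI impI)
    fix n :: int
    assume *: "\<forall>n. 0 < n \<longrightarrow> n < length (map z [t..-1] @ [v]) \<longrightarrow> (\<Sum>m = t..t + int n - 1. z m) < 0"
      and "t < n \<and> n \<le> 0"
    then show "(\<Sum>m = t..n - 1. z m) < 0" using *[rule_format, of "nat (n - t)"] by auto
  next
    fix n :: nat
    assume "\<forall>n. t < n \<and> n \<le> 0 \<longrightarrow> (\<Sum>m = t..n - 1. z m) < 0" "0 < n" "n < length (map z [t..-1] @ [v])"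
    then show "(\<Sum>m = t..t + int n - 1. z m) < 0" using assms by simp
  qed
  finally show ?thesis by (simp add: ladder_def sum_list_map_upto)
qed

text \<open>
  A walk with steps at least \<open>-1\<close> cannot jump over a level on its way down. So the walk read
  backwards along the block stays above its final level, which says that the prefix sums of the
  block are negative.
\<close>

lemma ladder_pass_block:
  assumes "pass_ok q" and "0 \<le> snd (fst q)" "snd (fst q) \<le> fst (fst q) - 1"
    and "\<And>m. m < 0 \<Longrightarrow> -1 \<le> snd q m"
  shows "ladder (pass_block q)"
proof -
  obtain z0 k z where q: "q = ((z0, k), z)" by (metis prod.collapse)
  define t where "t = pass_time (z0 - 1) k z"
  obtain n where n: "n \<le> 0" "- (z0 - 1) - (\<Sum>m = n..-1. z m) = - k"
    using assms(1) by (auto simp: pass_ok_def q)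
  note t = pass_time_props[OF n, folded t_def]
  \<comment> \<open>Downward induction from the empty sum at 0. One more letter lowers the sum by at
    most one, so it could only fall to the level exactly, and the maximality of \<open>t\<close>
    forbids this.\<close>
  have above: "k - (z0 - 1) < (\<Sum>m = n..-1. z m)" if "t < n" "n \<le> 0" for n
    using that(2,1)
  proof (induction n rule: int_le_induct)
    case base
    then show ?case using t(3)[of 0] assms(3) by (simp add: q)
  next
    case (step i)
    then have "k - (z0 - 1) < (\<Sum>m = i..-1. z m)" by simp
    moreover have "{i - 1..-1} = insert (i - 1) {i..-1}" using step.hyps by auto
    ultimately have "k - (z0 - 1) \<le> (\<Sum>m = i - 1..-1. z m)"
      using assms(4)[of "i - 1"] step.hyps by (simp add: q)
    then show ?case using t(3)[of "i - 1"] step by simp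
  qed
  \<comment> \<open>A prefix sum is the full sum, which equals the level, minus a suffix sum, which
    lies above the level.\<close>
  have "(\<Sum>m = t..n - 1. z m) < 0" if "t < n" "n \<le> 0" for n
    using above[OF that] t(2) sum_split_int[of t n "-1" z] that by simp
  then show ?thesis
    using t assms(2) ladder_block_iff[OF t(1), of z "z0 - 1"] by (simp add: pass_block_def q t_def)
qed

text \<open>Writing a prescribed ladder word is a cylinder event: it fixes \<open>(Z, K)\<close> and
  finitely many letters of the past, so its probability is a product.\<close>

lemma pass_block_eq_iff:
  assumes "ladder b"
  shows "pass_ok q \<and> pass_block q = b \<longleftrightarrow>
    fst q = (last b + 1, sum_list b) \<and>
    (\<forall>i<length b - 1. snd q (int i - int (length b - 1)) = b ! i)"
    (is "?L \<longleftrightarrow> ?R")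
proof
  obtain z0 k z where q: "q = ((z0, k), z)" by (metis prod.collapse)
  {
    assume L: ?L
    define t where "t = pass_time (z0 - 1) k z"
    obtain n where n: "n \<le> 0" "- (z0 - 1) - (\<Sum>m = n..-1. z m) = - k"
      using L by (auto simp: pass_ok_def q)
    note t = pass_time_props[OF n, folded t_def]
    have "b = map z [t..-1] @ [z0 - 1]"
      using L by (simp add: pass_block_def q t_def)
    then show ?R using t(1,2)
      by (auto simp: q nth_append sum_list_map_upto add.commute)
  next
    assume R: ?R
    define s where "s = length b - 1"
    have "b \<noteq> []" using assms by (simp add: ladder_def)
    have "butlast b = map z [- int s..-1]"
    proof (rule nth_equalityI)
      show "length (butlast b) = length (map z [- int s..-1])" by (simp add: s_def)
      fix i assume "i < length (butlast b)"
      then have "i < s" "butlast b ! i = b ! i" by (simp_all add: s_def nth_butlast)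
      moreover have "z (int i - int s) = b ! i"
        using R \<open>i < s\<close> unfolding s_def[symmetric] by (simp add: q)
      ultimately show "butlast b ! i = map z [- int s..-1] ! i" by simp
    qed
    then have b: "b = map z [- int s..-1] @ [z0 - 1]"
      using R append_butlast_last_id[OF \<open>b \<noteq> []\<close>] by (simp add: q)
    have k: "k = (\<Sum>m = - int s..-1. z m) + (z0 - 1)"
      using R arg_cong[OF b, of sum_list] by (simp add: q sum_list_map_upto)
    have neg: "(\<Sum>m = - int s..n - 1. z m) < 0" if "- int s < n" "n \<le> 0" for n
      using assms that ladder_block_iff[of "- int s" z "z0 - 1"] by (simp flip: b)
    have "pass_time (z0 - 1) k z = - int s"
      unfolding pass_time_def
    proof (rule cSup_eq_maximum)
      show "- int s \<in> {n. n \<le> 0 \<and> - (z0 - 1) - (\<Sum>m = n..-1. z m) = - k}"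
        using k by simp
      fix n assume n: "n \<in> {n. n \<le> 0 \<and> - (z0 - 1) - (\<Sum>m = n..-1. z m) = - k}"
      show "n \<le> - int s"
      \<comment> \<open>A time \<open>n\<close> closer to 0 would cut off a nonempty prefix of
        negative sum, leaving a suffix sum above the level.\<close>
      proof (rule ccontr)
        assume "\<not> n \<le> - int s"
        then have "(\<Sum>m = - int s..-1. z m) < (\<Sum>m = n..-1. z m)"
          using n neg[of n] by (subst sum_split_int[of "- int s" n]) auto
        with n k show False by auto
      qed
    qed
    then have "pass_block q = b" by (simp add: pass_block_def q b)
    moreover have "pass_ok q"
      using k by (auto simp: pass_ok_def q intro!: exI[of _ "- int s"])
    ultimately show ?L by simp
  }
qed

section \<open>Almost sure statements and measurability on product spaces\<close>

lemma AE_pair_fst: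
  assumes "sigma_finite_measure B" "AE x in A. P x"
  shows "AE q in A \<Otimes>\<^sub>M B. P (fst q)"
proof -
  interpret sigma_finite_measure B by fact
  obtain N where "N \<in> null_sets A" "{x \<in> space A. \<not> P x} \<subseteq> N"
    using assms(2) by (auto elim!: AE_E)
  then show ?thesis
    by (intro AE_I'[of "N \<times> space B"] times_in_null_sets1) (auto simp: space_pair_measure)
qed

lemma AE_pair_snd:
  assumes "sigma_finite_measure B" "AE y in B. P y"
  shows "AE q in A \<Otimes>\<^sub>M B. P (snd q)"
proof -
  interpret sigma_finite_measure B by fact
  obtain N where "N \<in> null_sets B" "{x \<in> space B. \<not> P x} \<subseteq> N"
    using assms(2) by (auto elim!: AE_E)
  then show ?thesis
    by (intro AE_I'[of "space A \<times> N"] times_in_null_sets2) (auto simp: space_pair_measure)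
qed

lemma pmf_bind_tagged: "pmf (bind_pmf p (\<lambda>z. map_pmf (\<lambda>k. (z, k)) (f z))) (z, k) = pmf p z * pmf (f z) k"
proof -
  have "pmf (map_pmf (\<lambda>k. (z', k)) (f z')) (z, k) = indicator {z} z' * pmf (f z) k" for z'
  proof (cases "z' = z")
    case True
    then show ?thesis by (simp add: pmf_map_inj' inj_def)
  next
    case False
    then show ?thesis by (auto simp: pmf_eq_0_set_pmf)
  qed
  then show ?thesis by (simp add: pmf_bind measure_pmf_single)
qed

text \<open>For \<open>i\<close> outside \<open>I\<close> the coordinate is the constant
  \<open>undefined\<close> on the space of the product, so \<open>i\<close> can range over all
  indices in later measurability proofs.\<close>

lemma measurable_PiM_pmf_component:
  fixes p :: "'b pmf"
  shows   "(\<lambda>z. z i) \<in> PiM I (\<lambda>_. measure_pmf p) \<rightarrow>\<^sub>M (count_space UNIV :: 'b measure)"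
proof (cases "i \<in> I")
  case True
  then show ?thesis by (intro measurable_compose[OF measurable_component_singleton]) auto
next
  case False
  then have "(\<lambda>z. z i) \<in> PiM I (\<lambda>_. measure_pmf p) \<rightarrow>\<^sub>M count_space UNIV \<longleftrightarrow>
      (\<lambda>z. undefined) \<in> PiM I (\<lambda>_. measure_pmf p) \<rightarrow>\<^sub>M (count_space UNIV :: 'b measure)"
    by (intro measurable_cong) (auto simp: space_PiM PiE_def extensional_def)
  then show ?thesis by simp
qed

text \<open>A least natural number over a countable family of events is the form in which
  measurability is automatic. If the level is never reached, the value is the constant
  \<open>Sup {}\<close>.\<close>

lemma pass_time_eq_Least:
  "pass_time y k z = (if \<exists>n. (\<Sum>m = - int n..-1. z m) = k - y
     then - int (LEAST n. (\<Sum>m = - int n..-1. z m) = k - y) else Sup {})"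
proof (cases "\<exists>n. (\<Sum>m = - int n..-1. z m) = k - y")
  case True
  then have L: "(\<Sum>m = - int (LEAST n. (\<Sum>m = - int n..-1. z m) = k - y)..-1. z m) = k - y"
    by (rule LeastI_ex)
  have "pass_time y k z = - int (LEAST n. (\<Sum>m = - int n..-1. z m) = k - y)"
    unfolding pass_time_def
  proof (rule cSup_eq_maximum)
    fix n assume "n \<in> {n. n \<le> 0 \<and> - y - (\<Sum>m = n..-1. z m) = - k}"
    then show "n \<le> - int (LEAST n. (\<Sum>m = - int n..-1. z m) = k - y)"
      using Least_le[of "\<lambda>n. (\<Sum>m = - int n..-1. z m) = k - y" "nat (- n)"] by (auto simp: le_nat_iff)
  qed (use L in simp)
  with True show ?thesis by simp
next
  case False
  have "\<not> (n \<le> 0 \<and> - y - (\<Sum>m = n..-1. z m) = - k)" for n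
    using False[simplified, rule_format, of "nat (- n)"] by auto
  then have "{n. n \<le> 0 \<and> - y - (\<Sum>m = n..-1. z m) = - k} = {}"
    by blast
  with False show ?thesis by (simp only: pass_time_def if_False)
qed

lemma measurable_pass_time [measurable]:
  assumes y [measurable]: "y \<in> M \<rightarrow>\<^sub>M count_space UNIV" and k [measurable]: "k \<in> M \<rightarrow>\<^sub>M count_space UNIV"
    and z [measurable]: "\<And>m. (\<lambda>x. z x m) \<in> M \<rightarrow>\<^sub>M count_space UNIV"
  shows "(\<lambda>x. pass_time (y x) (k x) (z x)) \<in> M \<rightarrow>\<^sub>M count_space UNIV"
proof -
  have [measurable]: "(\<lambda>x. k x - y x) \<in> M \<rightarrow>\<^sub>M count_space UNIV"
    by (rule measurable_compose_countable[OF _ y], rule measurable_compose_countable[OF _ k]) simp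
  have [measurable]: "Measurable.pred M (\<lambda>x. (\<Sum>m = - int n..-1. z x m) = k x - y x)" for n
    by (rule measurable_compose_countable[where g = "\<lambda>x. k x - y x"
          and f = "\<lambda>j x. (\<Sum>m = - int n..-1. z x m) = j"]) measurable
  show ?thesis unfolding pass_time_eq_Least by measurable
qed

section \<open>The law of the block written by a pass\<close>

lemma measurable_pass_block:
  "pass_block \<in> measure_pmf p \<Otimes>\<^sub>M PiM I (\<lambda>_. measure_pmf lam) \<rightarrow>\<^sub>M count_space UNIV"
proof -
  let ?N = "measure_pmf p \<Otimes>\<^sub>M PiM I (\<lambda>_. measure_pmf lam)"
  have fst_fst [measurable]: "(\<lambda>q. fst (fst q)) \<in> ?N \<rightarrow>\<^sub>M count_space UNIV"
    "(\<lambda>q. snd (fst q)) \<in> ?N \<rightarrow>\<^sub>M count_space UNIV"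
    by (auto intro!: measurable_compose[OF measurable_fst])
  have [measurable]: "(\<lambda>q. fst (fst q) - 1) \<in> ?N \<rightarrow>\<^sub>M count_space UNIV"
    by (rule measurable_compose[OF fst_fst(1)]) simp
  have [measurable]: "(\<lambda>q. snd q m) \<in> ?N \<rightarrow>\<^sub>M count_space UNIV" for m
    by (rule measurable_compose[OF measurable_snd measurable_PiM_pmf_component])
  have Cons: "(\<lambda>q. a q # as q) \<in> ?N \<rightarrow>\<^sub>M count_space UNIV"
    if [measurable]: "a \<in> ?N \<rightarrow>\<^sub>M count_space UNIV" "as \<in> ?N \<rightarrow>\<^sub>M count_space UNIV"
    for a :: "_ \<Rightarrow> int" and as
    by (rule measurable_compose_countable[OF _ that(1)], rule measurable_compose_countable[OF _ that(2)]) simp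
  have list: "(\<lambda>q. map (snd q) ms @ [fst (fst q) - 1]) \<in> ?N \<rightarrow>\<^sub>M count_space UNIV" for ms
    by (induction ms) (auto intro!: Cons)
  show ?thesis unfolding pass_block_def
    by (rule measurable_compose_countable[OF list]) measurable
qed

lemma prod_list_nth: "(\<Prod>i<length b. h (b ! i)) = prod_list (map h b)"
  for h :: "'a \<Rightarrow> 'b::comm_monoid_mult"
  by (simp add: prod.list_conv_set_nth atLeast0LessThan)

context mean_zero_skip_free
begin

definition past_measure :: "(int \<Rightarrow> int) measure" where
  "past_measure = (\<Pi>\<^sub>M n\<in>{..<0}. measure_pmf lam)"

definition pass_measure :: "pass_input measure" where
  "pass_measure = measure_pmf (pass_pmf lam) \<Otimes>\<^sub>M past_measure"

sublocale past: prob_space past_measure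
  unfolding past_measure_def by (rule prob_space_PiM) (rule measure_pmf.prob_space_axioms)

lemma prob_space_pass_measure: "prob_space pass_measure"
  unfolding pass_measure_def
  by (rule prob_space_pair) (rule measure_pmf.prob_space_axioms past.prob_space_axioms)+

sublocale pass: prob_space pass_measure
  by (rule prob_space_pass_measure)

lemma measurable_pass_block' [measurable]: "pass_block \<in> pass_measure \<rightarrow>\<^sub>M count_space UNIV"
  unfolding pass_measure_def past_measure_def by (rule measurable_pass_block)

text \<open>Read backwards from \<open>-1\<close>, the past is a walk with the law studied above, so
  the descent result applies to it.\<close>

lemma past_measure_reverse:
  "distr past_measure walk_measure (\<lambda>z i. z (- 1 - int i)) = walk_measure"
  using distr_PiM_reindex[of "{..<0::int}" "\<lambda>_. measure_pmf lam" "\<lambda>i. - 1 - int i" UNIV]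
  by (simp add: past_measure_def walk_measure_def inj_on_def measure_pmf.prob_space_axioms restrict_UNIV)

text \<open>All depths share one null set because the depth that a pass has to reach is itself
  random.\<close>

lemma AE_past_descends: "AE z in past_measure. \<forall>a\<ge>0. \<exists>n\<le>0. (\<Sum>m = n..-1. z m) = - a"
proof -
  have "AE z in walk_measure. \<forall>a. a \<ge> 0 \<longrightarrow> (\<exists>n. (\<Sum>i<n. z i) = - a)"
    using AE_walk_descends by (subst AE_all_countable) auto
  then have "AE z in distr past_measure walk_measure (\<lambda>z i. z (- 1 - int i)).
      \<forall>a. a \<ge> 0 \<longrightarrow> (\<exists>n. (\<Sum>i<n. z i) = - a)"
    by (simp only: past_measure_reverse)
  moreover have "(\<lambda>z i. z (- 1 - int i)) \<in> past_measure \<rightarrow>\<^sub>M walk_measure"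
    unfolding past_measure_def walk_measure_def
    by (rule measurable_PiM_single') (auto intro!: measurable_PiM_pmf_component)
  ultimately have "AE z in past_measure. \<forall>a. a \<ge> 0 \<longrightarrow> (\<exists>n. (\<Sum>i<n. z (- 1 - int i)) = - a)"
    using AE_distrD[of "\<lambda>z i. z (- 1 - int i)" past_measure walk_measure] by simp
  then show ?thesis
  proof eventually_elim
    case (elim z)
    have "(\<Sum>i<n. z (- 1 - int i)) = (\<Sum>m = - int n..-1. z m)" for n
      by (rule sum.reindex_bij_witness[of _ "\<lambda>m. nat (- 1 - m)" "\<lambda>i. - 1 - int i"]) auto
    with elim show ?case by (metis neg_le_0_iff_le of_nat_0_le_iff)
  qed
qed

lemma AE_past_ge: "AE z in past_measure. \<forall>m<0. -1 \<le> z m"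
proof -
  have "AE z in past_measure. m < 0 \<longrightarrow> -1 \<le> z m" for m
  proof (cases "m < 0")
    case True
    have "AE x in measure_pmf lam. -1 \<le> x" by (intro AE_pmfI ge_minus_one)
    then have "AE z in past_measure. -1 \<le> z m"
      unfolding past_measure_def
      by (intro AE_PiM_component[where P = "\<lambda>x. -1 \<le> x"])
         (use True in \<open>auto intro: measure_pmf.prob_space_axioms\<close>)
    then show ?thesis by simp
  qed simp
  then show ?thesis by (subst AE_all_countable) auto
qed

lemma pmf_offspring: "pmf (offspring_pmf lam) k = pmf lam (k - 1)"
  using pmf_map_inj'[of "\<lambda>x. x + 1" lam "k - 1"] by (simp add: offspring_pmf_def inj_def)

text \<open>The density of \<open>embed_pmf\<close> can be read off once the weights are known to
  have total mass one. This total is the mean of \<open>x + 1\<close>, which is where mean zero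
  enters.\<close>

lemma pmf_size_biased:
  "pmf (size_biased_pmf lam) k = (if k \<ge> 0 then real_of_int k * pmf lam (k - 1) else 0)"
proof -
  let ?f = "\<lambda>k. if k \<ge> 0 then real_of_int k * pmf (offspring_pmf lam) k else 0"
  have "(\<integral>\<^sup>+k. ennreal (?f k) \<partial>count_space UNIV) =
      (\<integral>\<^sup>+k. ennreal (pmf (offspring_pmf lam) k) * ennreal (real_of_int k) \<partial>count_space UNIV)"
    by (intro nn_integral_cong) (auto simp: ennreal_mult'[symmetric] mult.commute ennreal_neg)
  also have "\<dots> = (\<integral>\<^sup>+k. ennreal (real_of_int k) \<partial>offspring_pmf lam)"
    by (simp add: nn_integral_measure_pmf)
  also have "\<dots> = (\<integral>\<^sup>+x. ennreal (real_of_int x + 1) \<partial>lam)"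
    by (simp add: offspring_pmf_def)
  also have "\<dots> = ennreal (\<integral>x. real_of_int x + 1 \<partial>lam)"
  proof (rule nn_integral_eq_integral)
    show "AE x in lam. 0 \<le> real_of_int x + 1"
      using ge_minus_one by (intro AE_pmfI) force
  qed (use integrable_id in auto)
  also have "(\<integral>x. real_of_int x + 1 \<partial>lam) = 1"
    using integrable_id mean_zero by simp
  finally show ?thesis
    unfolding size_biased_pmf_def by (subst pmf_embed_pmf) (auto simp: pmf_offspring)
qed

lemma pmf_pass:
  assumes "0 \<le> k" "k \<le> v"
  shows "pmf (pass_pmf lam) (v + 1, k) = pmf lam v"
  using assms by (simp add: pass_pmf_def pmf_bind_tagged pmf_size_biased)

text \<open>The size-biased law does not charge 0, so \<open>{0..z - 1}\<close> is nonempty and the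
  uniform law on it has the expected support.\<close>

lemma set_pass_pmf: "(z, k) \<in> set_pmf (pass_pmf lam) \<Longrightarrow> 0 \<le> k \<and> k \<le> z - 1"
proof -
  assume "(z, k) \<in> set_pmf (pass_pmf lam)"
  then have z: "z \<in> set_pmf (size_biased_pmf lam)" and k: "k \<in> set_pmf (pmf_of_set {0..z - 1})"
    by (auto simp: pass_pmf_def)
  have "pmf (size_biased_pmf lam) z \<noteq> 0" using z by (simp add: set_pmf_iff)
  then have "0 < z" by (cases "z = 0") (auto simp: pmf_size_biased split: if_splits)
  with k show ?thesis by (subst (asm) set_pmf_of_set) auto
qed

lemma AE_pass: "AE q in pass_measure. pass_ok q \<and> ladder (pass_block q)"
proof -
  have "AE q in pass_measure. 0 \<le> snd (fst q) \<and> snd (fst q) \<le> fst (fst q) - 1"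
    unfolding pass_measure_def
    by (rule AE_pair_fst[OF past.sigma_finite_measure_axioms])
       (use set_pass_pmf in \<open>auto intro!: AE_pmfI\<close>)
  moreover have "AE q in pass_measure. (\<forall>m<0. -1 \<le> snd q m) \<and>
      (\<forall>a\<ge>0. \<exists>n\<le>0. (\<Sum>m = n..-1. snd q m) = - a)"
    unfolding pass_measure_def
    by (rule AE_pair_snd[OF past.sigma_finite_measure_axioms], rule AE_conjI)
       (rule AE_past_ge AE_past_descends)+
  ultimately show ?thesis
  proof eventually_elim
    case (elim q)
    then obtain n where n: "n \<le> 0" "(\<Sum>m = n..-1. snd q m) = - (fst (fst q) - 1 - snd (fst q))"
      by (metis diff_ge_0_iff_ge)
    then have "pass_ok q" by (auto simp: pass_ok_def intro!: exI[of _ n])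
    with elim ladder_pass_block[of q] show ?case by simp
  qed
qed

definition word_weight :: "int list \<Rightarrow> ennreal" where
  "word_weight b = prod_list (map (\<lambda>x. ennreal (pmf lam x)) b)"

text \<open>The event is a rectangle: a single pair \<open>(Z, K)\<close>, of mass
  \<open>pmf lam v\<close>, times a cylinder of the past whose mass is the weight of the remaining
  letters.\<close>

lemma emeasure_pass_block:
  assumes "ladder b"
  shows "{q \<in> space pass_measure. pass_ok q \<and> pass_block q = b} \<in> sets pass_measure"
    and "emeasure pass_measure {q \<in> space pass_measure. pass_ok q \<and> pass_block q = b} = word_weight b"
proof -
  define s where "s = length b - 1"
  define v where "v = last b"
  define A where "A = {z \<in> space past_measure. \<forall>j\<in>(\<lambda>i. int i - int s) ` {..<s}. z j \<in> {b ! nat (j + int s)}}"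
  have "b \<noteq> []" using assms by (simp add: ladder_def)
  have "{q \<in> space pass_measure. pass_ok q \<and> pass_block q = b} = {(v + 1, sum_list b)} \<times> A"
    unfolding pass_block_eq_iff[OF assms] s_def[symmetric] v_def[symmetric]
    by (auto simp: pass_measure_def space_pair_measure A_def)
  moreover have A: "A \<in> sets past_measure"
  proof -
    have [measurable]: "(\<lambda>z. z j) \<in> past_measure \<rightarrow>\<^sub>M count_space UNIV" for j
      unfolding past_measure_def by (rule measurable_PiM_pmf_component)
    show ?thesis unfolding A_def by (rule sets.sets_Collect_finite_All) (simp, measurable)
  qed
  ultimately show "{q \<in> space pass_measure. pass_ok q \<and> pass_block q = b} \<in> sets pass_measure"
    unfolding pass_measure_def by auto
  interpret past_product: product_prob_space "\<lambda>_. measure_pmf lam" "{..<0::int}" ..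
  have b: "b = butlast b @ [v]" using \<open>b \<noteq> []\<close> by (simp add: v_def)
  \<comment> \<open>This gives \<open>K <= v\<close>, as \<open>pmf_pass\<close> requires. A
    one-letter word leaves the empty sum; otherwise \<open>butlast b\<close> is a proper nonempty
    prefix.\<close>
  have "sum_list (butlast b) \<le> 0"
  proof (cases "s = 0")
    case True
    then show ?thesis using \<open>b \<noteq> []\<close> by (cases b) (auto simp: s_def)
  next
    case False
    then show ?thesis using assms by (auto simp: ladder_def butlast_conv_take s_def less_imp_le)
  qed
  then have "sum_list b \<le> v" by (subst b) simp
  moreover have "0 \<le> sum_list b" using assms by (simp add: ladder_def)
  ultimately have pmf_v: "pmf (pass_pmf lam) (v + 1, sum_list b) = pmf lam v"
    by (intro pmf_pass)
  have "emeasure past_measure A = (\<Prod>j\<in>(\<lambda>i. int i - int s) ` {..<s}. emeasure lam {b ! nat (j + int s)})"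
    unfolding A_def past_measure_def by (rule past_product.emeasure_PiM_Collect) auto
  also have "\<dots> = (\<Prod>i<s. ennreal (pmf lam (butlast b ! i)))"
    by (subst prod.reindex) (auto simp: inj_on_def emeasure_pmf_single nth_butlast s_def intro!: prod.cong)
  also have "\<dots> = word_weight (butlast b)"
    using prod_list_nth[of "\<lambda>x. ennreal (pmf lam x)" "butlast b"] by (simp add: word_weight_def s_def)
  finally have "emeasure past_measure A = word_weight (butlast b)" .
  then have "emeasure pass_measure ({(v + 1, sum_list b)} \<times> A) = ennreal (pmf lam v) * word_weight (butlast b)"
    unfolding pass_measure_def
    by (subst past.emeasure_pair_measure_Times) (use A in \<open>auto simp: emeasure_pmf_single pmf_v\<close>)
  also have "\<dots> = word_weight b"
    by (subst (2) b) (simp add: word_weight_def mult.commute)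
  finally show "emeasure pass_measure {q \<in> space pass_measure. pass_ok q \<and> pass_block q = b} = word_weight b"
    using \<open>_ = {(v + 1, sum_list b)} \<times> A\<close> by simp
qed

text \<open>The pass produces some ladder word almost surely, so the weights of these words add up to one.\<close>

lemma sum_word_weight: "(\<integral>\<^sup>+b. word_weight b \<partial>count_space {b. ladder b}) = 1"
proof -
  define F where "F b = {q \<in> space pass_measure. pass_ok q \<and> pass_block q = b}" for b
  have "emeasure pass_measure (\<Union>b\<in>{b. ladder b}. F b) =
      (\<integral>\<^sup>+b. emeasure pass_measure (F b) \<partial>count_space {b. ladder b})"
    by (rule emeasure_UN_countable)
       (auto simp: F_def emeasure_pass_block(1) disjoint_family_on_def)
  also have "\<dots> = (\<integral>\<^sup>+b. word_weight b \<partial>count_space {b. ladder b})"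
    by (intro nn_integral_cong) (auto simp: F_def emeasure_pass_block(2))
  finally have "(\<integral>\<^sup>+b. word_weight b \<partial>count_space {b. ladder b}) = emeasure pass_measure (\<Union>b\<in>{b. ladder b}. F b)" ..
  moreover have "AE q in pass_measure. q \<in> (\<Union>b\<in>{b. ladder b}. F b)"
    using AE_pass AE_space by eventually_elim (auto simp: F_def)
  moreover have "(\<Union>b\<in>{b. ladder b}. F b) \<in> sets pass_measure"
    by (intro sets.countable_UN') (auto simp: F_def emeasure_pass_block(1))
  ultimately show ?thesis using pass.emeasure_eq_1_AE by simp
qed

text \<open>The events of writing \<open>b\<close>, over the countably many ladder words, partition
  the space up to a null set.\<close>

lemma nn_integral_pass_block:
  fixes g :: "int list \<Rightarrow> ennreal"
  shows "(\<integral>\<^sup>+q. g (pass_block q) \<partial>pass_measure) = (\<integral>\<^sup>+b. word_weight b * g b \<partial>count_space {b. ladder b})"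
proof -
  define F where "F b = {q \<in> space pass_measure. pass_ok q \<and> pass_block q = b}" for b
  have "(\<integral>\<^sup>+q. g (pass_block q) \<partial>pass_measure) =
      (\<integral>\<^sup>+q. (\<integral>\<^sup>+b. g b * indicator (F b) q \<partial>count_space {b. ladder b}) \<partial>pass_measure)"
  proof (rule nn_integral_cong_AE)
    show "AE q in pass_measure. g (pass_block q) = (\<integral>\<^sup>+b. g b * indicator (F b) q \<partial>count_space {b. ladder b})"
      using AE_pass AE_space
    proof eventually_elim
      case (elim q)
      then show ?case
        by (subst nn_integral_count_space'[of "{pass_block q}"]) (auto simp: F_def)
    qed
  qed
  also have "\<dots> = (\<integral>\<^sup>+b. (\<integral>\<^sup>+q. g b * indicator (F b) q \<partial>pass_measure) \<partial>count_space {b. ladder b})"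
    by (rule nn_integral_count_space_nn_integral)
       (auto simp: F_def intro!: borel_measurable_times_ennreal borel_measurable_indicator emeasure_pass_block(1))
  also have "\<dots> = (\<integral>\<^sup>+b. word_weight b * g b \<partial>count_space {b. ladder b})"
    by (intro nn_integral_cong)
       (simp add: F_def emeasure_pass_block nn_integral_cmult_indicator mult.commute)
  finally show ?thesis .
qed

end

section \<open>Record steps on an i.i.d. line\<close>

text \<open>With a countable base for the coordinates, the Borel sets of sequences indexed by the
  integers are those of the product sigma-algebra.\<close>

instance int :: second_countable_topology
proof
  show "\<exists>B::int set set. countable B \<and> open = generate_topology B"
    by (intro exI[of _ "range lessThan \<union> range greaterThan"]) (auto simp: open_int_def)
qed

lemma measurable_int_seqI:
  fixes f :: "'a \<Rightarrow> int \<Rightarrow> int"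
  assumes "\<And>i. (\<lambda>x. f x i) \<in> M \<rightarrow>\<^sub>M count_space UNIV"
  shows "f \<in> M \<rightarrow>\<^sub>M borel"
proof (rule measurable_coordinatewise_then_product)
  fix i show "(\<lambda>x. f x i) \<in> borel_measurable M"
    using assms[of i] measurable_cong_sets[OF refl sets_borel_eq_count_space] by blast
qed

lemma measurable_borel_component [measurable]:
  "(\<lambda>x :: int \<Rightarrow> int. x i) \<in> borel \<rightarrow>\<^sub>M count_space UNIV"
proof -
  have "(\<lambda>x :: int \<Rightarrow> int. x i) \<in> borel \<rightarrow>\<^sub>M borel"
    by (intro borel_measurable_continuous_onI continuous_on_product_coordinates)
  then show ?thesis
    using measurable_cong_sets[OF refl sets_borel_eq_count_space] by blast
qed

lemma measurable_rooted_line [measurable]: "rooted_line i \<in> borel \<rightarrow>\<^sub>M borel"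
  unfolding rooted_line_def by (rule measurable_int_seqI) simp

lemma rooted_line_add: "rooted_line i (rooted_line j x) = rooted_line (j + i) x"
  by (simp add: rooted_line_def fun_eq_iff ac_simps)

text \<open>The right side sees \<open>x\<close> only through the line rooted at \<open>i\<close>,
  which gives covariance under translation, and it is measurable by its form. The offset is
  \<open>i + 1\<close> because the sum over \<open>0..n\<close> has \<open>n + 1\<close>
  terms.\<close>

lemma record_map_eq_Least:
  "record_map x i = (if \<exists>n. 0 \<le> (\<Sum>l = 0..int n. rooted_line i x l)
     then i + 1 + int (LEAST n. 0 \<le> (\<Sum>l = 0..int n. rooted_line i x l)) else i)"
proof -
  define Q where "Q n \<longleftrightarrow> 0 \<le> (\<Sum>l = 0..int n. rooted_line i x l)" for n
  have Q: "0 \<le> (\<Sum>l = i..i + 1 + int n - 1. x l) \<longleftrightarrow> Q n" for n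
  proof -
    have "(\<Sum>l = i..i + 1 + int n - 1. x l) = (\<Sum>l = 0..int n. rooted_line i x l)"
      by (rule sum.reindex_bij_witness[of _ "\<lambda>l. l + i" "\<lambda>l. l - i"]) (auto simp: rooted_line_def)
    then show ?thesis by (simp only: Q_def)
  qed
  have Q': "0 \<le> (\<Sum>l = i..j - 1. x l) \<longleftrightarrow> Q (nat (j - i - 1))" if "i < j" for j
    using Q[of "nat (j - i - 1)"] that by simp
  show ?thesis
  proof (cases "\<exists>n. Q n")
    case True
    have "Inf {j. i < j \<and> 0 \<le> (\<Sum>l = i..j - 1. x l)} = i + 1 + int (LEAST n. Q n)"
    proof (rule cInf_eq_minimum)
      show "i + 1 + int (LEAST n. Q n) \<in> {j. i < j \<and> 0 \<le> (\<Sum>l = i..j - 1. x l)}"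
        using LeastI_ex[OF True] Q by simp
      fix j assume "j \<in> {j. i < j \<and> 0 \<le> (\<Sum>l = i..j - 1. x l)}"
      then have "i < j" "Q (nat (j - i - 1))" using Q' by auto
      with Least_le[of Q] have "(LEAST n. Q n) \<le> nat (j - i - 1)" by blast
      with \<open>i < j\<close> show "i + 1 + int (LEAST n. Q n) \<le> j" by linarith
    qed
    moreover have "\<exists>j>i. 0 \<le> (\<Sum>l = i..j - 1. x l)"
    proof -
      obtain n where "Q n" using True by blast
      then show ?thesis using Q by (intro exI[of _ "i + 1 + int n"]) simp
    qed
    ultimately show ?thesis
      using True unfolding Q_def[symmetric] by (simp add: record_map_def)
  next
    case False
    then have "\<not> (\<exists>j>i. 0 \<le> (\<Sum>l = i..j - 1. x l))" using Q' by blast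
    with False show ?thesis unfolding Q_def[symmetric] by (simp only: record_map_def if_False)
  qed
qed

definition record_step :: "(int \<Rightarrow> int) \<Rightarrow> int \<Rightarrow> int" where
  "record_step x = rooted_line (record_map x 0) x"

lemma record_map_rooted_line: "record_map x i = i + record_map (rooted_line i x) 0"
  unfolding record_map_eq_Least[of x i] record_map_eq_Least[of _ 0] by (simp add: rooted_line_add)

text \<open>By translation covariance, the next record is found by rerooting at the current one and
  starting again from 0. The line seen from the successive records is thus the orbit of a single map
  on sequences.\<close>

lemma rooted_line_record_iterate:
  "rooted_line ((record_map x ^^ n) 0) x = (record_step ^^ n) x"
proof (induction n)
  case 0
  then show ?case by (simp add: rooted_line_def)
next
  case (Suc n)
  let ?r = "(record_map x ^^ n) 0"
  have "rooted_line ((record_map x ^^ Suc n) 0) x = rooted_line (?r + record_map (rooted_line ?r x) 0) x"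
    by (simp add: record_map_rooted_line[of x ?r])
  also have "\<dots> = record_step (rooted_line ?r x)"
    by (simp add: record_step_def rooted_line_add)
  finally show ?case by (simp add: Suc)
qed

lemma measurable_record_map [measurable]: "(\<lambda>x. record_map x 0) \<in> borel \<rightarrow>\<^sub>M count_space UNIV"
proof -
  have *: "rooted_line 0 x = x" for x by (simp add: rooted_line_def)
  have [measurable]: "Measurable.pred borel (\<lambda>x :: int \<Rightarrow> int. 0 \<le> (\<Sum>l = 0..int n. x l))" for n
    by (rule measurable_compose[of "\<lambda>x :: int \<Rightarrow> int. \<Sum>l = 0..int n. x l" _ "count_space UNIV"]) measurable
  show ?thesis
    unfolding record_map_eq_Least * by measurable
qed

lemma measurable_record_step [measurable]: "record_step \<in> borel \<rightarrow>\<^sub>M borel"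
  unfolding record_step_def
  by (rule measurable_compose_countable[where f = "\<lambda>i x. rooted_line i x"]) measurable

lemma measurable_record_step_iterate [measurable]: "record_step ^^ n \<in> borel \<rightarrow>\<^sub>M borel"
proof (induction n)
  case (Suc n)
  then show ?case using measurable_comp[OF Suc measurable_record_step] by (simp add: comp_def)
qed (simp add: id_def)

text \<open>The word is aligned at its right end, just left of the root, so extending it on the left
  does not move the letters already placed.\<close>

definition overwrite :: "int list \<Rightarrow> (int \<Rightarrow> int) \<Rightarrow> int \<Rightarrow> int" where
  "overwrite c y i = (if - int (length c) \<le> i \<and> i < 0 then c ! nat (i + int (length c)) else y i)"

lemma measurable_overwrite:
  assumes "c \<in> M \<rightarrow>\<^sub>M count_space UNIV" and y [measurable]: "\<And>i. (\<lambda>x. y x i) \<in> M \<rightarrow>\<^sub>M count_space UNIV"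
  shows "(\<lambda>x. overwrite (c x) (y x)) \<in> M \<rightarrow>\<^sub>M borel"
  by (rule measurable_compose_countable[OF _ assms(1)], rule measurable_int_seqI)
     (simp add: overwrite_def)

lemma measurable_overwrite_const [measurable]: "overwrite c \<in> borel \<rightarrow>\<^sub>M borel"
  by (rule measurable_overwrite) auto

lemma overwrite_Nil [simp]: "overwrite [] y = y"
  by (auto simp: overwrite_def)

definition prefix_set :: "int list \<Rightarrow> (int \<Rightarrow> int) set" where
  "prefix_set b = {x. \<forall>i<length b. x (int i) = b ! i}"

lemma record_map_prefix:
  assumes "ladder b" "x \<in> prefix_set b"
  shows "record_map x 0 = int (length b)"
proof -
  have sum: "(\<Sum>l = 0..int n. x l) = sum_list (take (Suc n) b)" if "n < length b" for n
  proof -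
    have "(\<Sum>l = 0..int n. x l) = (\<Sum>i<Suc n. x (int i))"
      by (rule sum.reindex_bij_witness[of _ int nat]) auto
    also have "\<dots> = (\<Sum>i<Suc n. b ! i)"
      using assms(2) that by (intro sum.cong) (auto simp: prefix_set_def)
    also have "\<dots> = sum_list (take (Suc n) b)"
      using that by (subst sum_list_sum_nth) (auto intro!: sum.cong)
    finally show ?thesis .
  qed
  obtain m where m: "length b = Suc m"
    using assms(1) by (cases b) (auto simp: ladder_def)
  have at: "0 \<le> (\<Sum>l = 0..int m. x l)"
    using sum[of m] m assms(1) by (simp add: ladder_def)
  have "(LEAST n. 0 \<le> (\<Sum>l = 0..int n. x l)) = m"
  proof (rule Least_equality)
    show "0 \<le> (\<Sum>l = 0..int m. x l)" by (rule at)
    fix n assume n: "0 \<le> (\<Sum>l = 0..int n. x l)"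
    show "m \<le> n"
    proof (rule ccontr)
      assume "\<not> m \<le> n"
      then have "n < length b" "sum_list (take (Suc n) b) < 0"
        using m assms(1) by (simp_all add: ladder_def)
      with sum[of n] n show False by simp
    qed
  qed
  moreover have "rooted_line 0 x = x" by (simp add: rooted_line_def)
  ultimately show ?thesis
    using at m unfolding record_map_eq_Least by auto
qed

text \<open>Both words have length \<open>record_map x 0\<close> and spell the same letters of
  \<open>x\<close>.\<close>

lemma prefix_set_unique:
  assumes "ladder b" "ladder b'" "x \<in> prefix_set b" "x \<in> prefix_set b'"
  shows "b = b'"
  using assms record_map_prefix[of b x] record_map_prefix[of b' x]
  by (auto simp: prefix_set_def intro!: nth_equalityI)

lemma overwrite_prefix: "x \<in> prefix_set (b::int list) \<Longrightarrow> overwrite c x \<in> prefix_set b"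
  by (auto simp: prefix_set_def overwrite_def)

text \<open>The record map looks only to the right of the root, so it ignores \<open>c\<close>.
  Rerooting moves \<open>b\<close> to the left of the root, between \<open>c\<close> and the rest of
  the line.\<close>

lemma record_step_overwrite:
  assumes "ladder b" "x \<in> prefix_set b"
  shows "record_step (overwrite c x) = overwrite (c @ b) (rooted_line (int (length b)) x)"
proof -
  have "record_map (overwrite c x) 0 = int (length b)"
    using assms by (intro record_map_prefix overwrite_prefix)
  moreover have "b ! nat (i + int (length b)) = x (i + int (length b))"
    if "- int (length b) \<le> i" "i < 0" for i
  proof -
    have "nat (i + int (length b)) < length b" "int (nat (i + int (length b))) = i + int (length b)"
      using that by auto
    with assms(2) show ?thesis unfolding prefix_set_def by (metis (mono_tags) mem_Collect_eq)
  qed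
  moreover have "nat (i + (int (length b) + int (length c))) - length c = nat (i + int (length b))"
    if "\<not> i + int (length b) < 0" for i
    using that by linarith
  ultimately show ?thesis
    by (auto simp: record_step_def rooted_line_def overwrite_def fun_eq_iff nth_append nat_less_iff
        algebra_simps nat_diff_distrib' intro!: arg_cong[where f = "(!) c"])
qed

section \<open>The i.i.d. line and the effect of one record step on it\<close>

context mean_zero_skip_free
begin

definition line_measure :: "(int \<Rightarrow> int) measure" where
  "line_measure = (\<Pi>\<^sub>M n\<in>UNIV. measure_pmf lam)"

sublocale line: prob_space line_measure
  unfolding line_measure_def by (rule prob_space_PiM) (rule measure_pmf.prob_space_axioms)

lemma sets_line_measure [measurable_cong]: "sets line_measure = sets borel"
proof -
  have "sets line_measure = sets (\<Pi>\<^sub>M n\<in>(UNIV :: int set). (borel :: int measure))"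
    unfolding line_measure_def by (intro sets_PiM_cong) (auto simp: sets_borel_eq_count_space)
  then show ?thesis by (simp add: sets_PiM_equal_borel)
qed

lemma space_line_measure [simp]: "space line_measure = UNIV"
  using sets_eq_imp_space_eq[OF sets_line_measure] by simp

lemma line_measure_shift: "distr line_measure borel (rooted_line t) = line_measure"
proof -
  have "distr line_measure line_measure (rooted_line t) = line_measure"
    using distr_PiM_reindex[of "UNIV :: int set" "\<lambda>_. measure_pmf lam" "\<lambda>i. i + t" UNIV]
    by (simp add: line_measure_def rooted_line_def inj_on_def measure_pmf.prob_space_axioms restrict_UNIV
        cong: distr_cong)
  moreover have "distr line_measure line_measure (rooted_line t) = distr line_measure borel (rooted_line t)"
    by (rule distr_cong) (auto simp: sets_line_measure)
  ultimately show ?thesis by simp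
qed

lemma line_measure_resample:
  "distr (measure_pmf lam \<Otimes>\<^sub>M line_measure) line_measure (\<lambda>(u, x). x(j := u)) = line_measure"
  using distr_pair_PiM_eq_PiM[of "UNIV :: int set" "\<lambda>_. measure_pmf lam" j]
  by (simp add: line_measure_def measure_pmf.prob_space_axioms)

lemma measurable_resample:
  "(\<lambda>(u, x). x(j := u)) \<in> measure_pmf lam \<Otimes>\<^sub>M line_measure \<rightarrow>\<^sub>M line_measure"
proof -
  have "(\<lambda>(u, x). x(j := u)) \<in> measure_pmf lam \<Otimes>\<^sub>M line_measure \<rightarrow>\<^sub>M borel"
  proof (rule measurable_int_seqI)
    fix i
    have "(\<lambda>p. if i = j then fst p else snd p i) \<in> measure_pmf lam \<Otimes>\<^sub>M line_measure \<rightarrow>\<^sub>M count_space UNIV"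
      by measurable
    then show "(\<lambda>p. (case p of (u, x) \<Rightarrow> x(j := u)) i) \<in> measure_pmf lam \<Otimes>\<^sub>M line_measure \<rightarrow>\<^sub>M count_space UNIV"
      by (rule measurable_cong[THEN iffD1, rotated]) auto
  qed
  then show ?thesis by (simp add: measurable_cong_sets[OF refl sets_line_measure])
qed

text \<open>Independence in the form of resampling: replacing coordinate \<open>j\<close> by a fresh
  letter preserves the law, \<open>g\<close> does not see it, and the indicator then concerns the
  fresh letter alone.\<close>

lemma nn_integral_fix_coordinate:
  assumes g [measurable]: "g \<in> borel_measurable borel" and indep: "\<And>x u. g (x(j := u)) = g x"
  shows "(\<integral>\<^sup>+x. indicator {x. x j = v} x * g x \<partial>line_measure) =
    ennreal (pmf lam v) * (\<integral>\<^sup>+x. g x \<partial>line_measure)"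
proof -
  note [measurable] = measurable_resample
  have [measurable]: "g \<in> borel_measurable line_measure"
    using g by (simp add: measurable_cong_sets[OF sets_line_measure refl])
  have [measurable]: "(\<lambda>p. indicator {v} (fst p) * g (snd p)) \<in> borel_measurable (measure_pmf lam \<Otimes>\<^sub>M line_measure)"
    by (intro borel_measurable_times_ennreal measurable_compose[OF measurable_fst] measurable_compose[OF measurable_snd]) auto
  have [measurable]: "{x :: int \<Rightarrow> int. x j = v} \<in> sets borel"
  proof -
    have "Measurable.pred borel (\<lambda>x :: int \<Rightarrow> int. x j = v)" by measurable
    then show ?thesis by (simp add: pred_def)
  qed
  have "(\<integral>\<^sup>+x. indicator {x. x j = v} x * g x \<partial>line_measure) =
      (\<integral>\<^sup>+x. indicator {x. x j = v} x * g x
         \<partial>distr (measure_pmf lam \<Otimes>\<^sub>M line_measure) line_measure (\<lambda>(u, x). x(j := u)))"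
    by (simp only: line_measure_resample)
  also have "\<dots> = (\<integral>\<^sup>+p. indicator {v} (fst p) * g (snd p) \<partial>(measure_pmf lam \<Otimes>\<^sub>M line_measure))"
    by (subst nn_integral_distr)
       (auto intro!: nn_integral_cong simp: indep split: split_indicator)
  also have "\<dots> = (\<integral>\<^sup>+u. \<integral>\<^sup>+x. indicator {v} u * g x \<partial>line_measure \<partial>measure_pmf lam)"
    by (subst line.nn_integral_fst[symmetric]) auto
  also have "\<dots> = (\<integral>\<^sup>+u. (\<integral>\<^sup>+x. g x \<partial>line_measure) * indicator {v} u \<partial>measure_pmf lam)"
    by (intro nn_integral_cong) (subst nn_integral_cmult, auto simp: mult.commute)
  also have "\<dots> = ennreal (pmf lam v) * (\<integral>\<^sup>+x. g x \<partial>line_measure)"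
    by (simp add: emeasure_pmf_single mult.commute)
  finally show ?thesis .
qed

lemma nn_integral_fix_coordinates:
  assumes "finite J" and "g \<in> borel_measurable borel"
    and "\<And>j x u. j \<in> J \<Longrightarrow> g (x(j := u)) = g x"
  shows "(\<integral>\<^sup>+x. indicator {x. \<forall>j\<in>J. x j = \<beta> j} x * g x \<partial>line_measure) =
    (\<Prod>j\<in>J. ennreal (pmf lam (\<beta> j))) * (\<integral>\<^sup>+x. g x \<partial>line_measure)"
  using assms
proof (induction J)
  case empty
  then show ?case by simp
next
  case (insert j J)
  note [measurable] = insert.prems(1)
  have [measurable]: "{x. \<forall>j\<in>J. x j = \<beta> j} \<in> sets borel"
  proof -
    have "Measurable.pred borel (\<lambda>x. \<forall>j\<in>J. x j = \<beta> j)"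
      using insert.hyps(1) by measurable
    then show ?thesis by (simp add: pred_def)
  qed
  have "(\<integral>\<^sup>+x. indicator {x. \<forall>j\<in>insert j J. x j = \<beta> j} x * g x \<partial>line_measure) =
      (\<integral>\<^sup>+x. indicator {x. x j = \<beta> j} x * (indicator {x. \<forall>j\<in>J. x j = \<beta> j} x * g x) \<partial>line_measure)"
    by (intro nn_integral_cong) (auto split: split_indicator)
  also have "\<dots> = ennreal (pmf lam (\<beta> j)) *
      (\<integral>\<^sup>+x. indicator {x. \<forall>j\<in>J. x j = \<beta> j} x * g x \<partial>line_measure)"
  proof (rule nn_integral_fix_coordinate)
    fix x u
    have "g (x(j := u)) = g x" using insert.prems(2) by blast
    moreover have "(\<forall>k\<in>J. (x(j := u)) k = \<beta> k) \<longleftrightarrow> (\<forall>k\<in>J. x k = \<beta> k)"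
      using insert.hyps(2) by auto
    ultimately show "indicator {x. \<forall>j\<in>J. x j = \<beta> j} (x(j := u)) * g (x(j := u)) =
        indicator {x. \<forall>j\<in>J. x j = \<beta> j} x * g x"
      by (simp only: indicator_def mem_Collect_eq)
  qed simp
  finally show ?case
    using insert by (simp add: mult.assoc)
qed

lemma measurable_prefix_set [measurable]: "prefix_set b \<in> sets borel"
proof -
  have "Measurable.pred borel (\<lambda>x. \<forall>i<length b. x (int i) = b ! i)" by measurable
  then show ?thesis by (simp add: pred_def prefix_set_def)
qed

text \<open>After the shift, the letters of \<open>b\<close> sit where \<open>overwrite\<close>
  replaces them, so the integrand does not depend on those coordinates and the weight of
  \<open>b\<close> factors out. Stationarity then removes the shift.\<close>

lemma nn_integral_prefix:
  assumes f [measurable]: "f \<in> borel_measurable borel"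
  shows "(\<integral>\<^sup>+x. indicator (prefix_set b) x * f (overwrite (c @ b) (rooted_line (int (length b)) x)) \<partial>line_measure) =
    word_weight b * (\<integral>\<^sup>+x. f (overwrite (c @ b) x) \<partial>line_measure)"
proof -
  let ?g = "\<lambda>x. f (overwrite (c @ b) (rooted_line (int (length b)) x))"
  have "prefix_set b = {x. \<forall>j\<in>int ` {..<length b}. x j = b ! nat j}"
    by (auto simp: prefix_set_def)
  then have "(\<integral>\<^sup>+x. indicator (prefix_set b) x * ?g x \<partial>line_measure) =
      (\<integral>\<^sup>+x. indicator {x. \<forall>j\<in>int ` {..<length b}. x j = b ! nat j} x * ?g x \<partial>line_measure)"
    by simp
  also have "\<dots> = (\<Prod>j\<in>int ` {..<length b}. ennreal (pmf lam (b ! nat j))) * (\<integral>\<^sup>+x. ?g x \<partial>line_measure)"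
  proof (rule nn_integral_fix_coordinates)
    fix j x u assume "j \<in> int ` {..<length b}"
    then have "overwrite (c @ b) (rooted_line (int (length b)) (x(j := u))) =
        overwrite (c @ b) (rooted_line (int (length b)) x)"
      by (auto simp: overwrite_def rooted_line_def fun_eq_iff)
    then show "?g (x(j := u)) = ?g x" by simp
  qed auto
  also have "(\<Prod>j\<in>int ` {..<length b}. ennreal (pmf lam (b ! nat j))) = word_weight b"
    using prod_list_nth[of "\<lambda>x. ennreal (pmf lam x)" b]
    by (subst prod.reindex) (auto simp: word_weight_def)
  also have "(\<integral>\<^sup>+x. ?g x \<partial>line_measure) =
      (\<integral>\<^sup>+x. f (overwrite (c @ b) x) \<partial>distr line_measure borel (rooted_line (int (length b))))"
    by (subst nn_integral_distr) auto
  finally show ?thesis by (simp only: line_measure_shift)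
qed

text \<open>A ladder word has the same probability as a prefix of the line as it has as the block of
  a pass, and the latter probabilities add up to one. So the almost sure existence of a record is
  inherited from the passes.\<close>

lemma AE_prefix: "AE x in line_measure. \<exists>b. ladder b \<and> x \<in> prefix_set b"
proof -
  have "emeasure line_measure (\<Union>b\<in>{b. ladder b}. prefix_set b) =
      (\<integral>\<^sup>+b. emeasure line_measure (prefix_set b) \<partial>count_space {b. ladder b})"
    by (rule emeasure_UN_countable)
       (auto simp: disjoint_family_on_def sets_line_measure dest: prefix_set_unique)
  also have "\<dots> = (\<integral>\<^sup>+b. word_weight b \<partial>count_space {b. ladder b})"
  proof (intro nn_integral_cong)
    fix b
    show "emeasure line_measure (prefix_set b) = word_weight b"
      using nn_integral_prefix[of "\<lambda>_. 1" b "[]"] by (simp add: line.emeasure_space_1[simplified])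
  qed
  finally have "emeasure line_measure (\<Union>b\<in>{b. ladder b}. prefix_set b) = 1"
    by (simp add: sum_word_weight)
  moreover have "(\<Union>b\<in>{b. ladder b}. prefix_set b) \<in> sets line_measure"
    by (intro sets.countable_UN') (auto simp: sets_line_measure)
  ultimately have "AE x in line_measure. x \<in> (\<Union>b\<in>{b. ladder b}. prefix_set b)"
    using line.prob_eq_1[of "\<Union>b\<in>{b. ladder b}. prefix_set b"]
    by (simp only: line.emeasure_eq_measure ennreal_eq_1)
  then show ?thesis by auto
qed

text \<open>Both sides are the same sum over ladder words: the left by the prefix of the line, the
  right by the block of the pass.\<close>

lemma nn_integral_record_step:
  assumes f [measurable]: "f \<in> borel_measurable borel"
  shows "(\<integral>\<^sup>+x. f (record_step (overwrite c x)) \<partial>line_measure) =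
    (\<integral>\<^sup>+q. \<integral>\<^sup>+x. f (overwrite (c @ pass_block q) x) \<partial>line_measure \<partial>pass_measure)"
proof -
  let ?g = "\<lambda>b x. f (overwrite (c @ b) (rooted_line (int (length b)) x))"
  have "(\<integral>\<^sup>+x. f (record_step (overwrite c x)) \<partial>line_measure) =
      (\<integral>\<^sup>+x. \<integral>\<^sup>+b. indicator (prefix_set b) x * ?g b x \<partial>count_space {b. ladder b} \<partial>line_measure)"
  proof (rule nn_integral_cong_AE)
    show "AE x in line_measure. f (record_step (overwrite c x)) =
        (\<integral>\<^sup>+b. indicator (prefix_set b) x * ?g b x \<partial>count_space {b. ladder b})"
      using AE_prefix
    proof eventually_elim
      case (elim x)
      then obtain b where b: "ladder b" "x \<in> prefix_set b" by blast
      then have "(\<integral>\<^sup>+b. indicator (prefix_set b) x * ?g b x \<partial>count_space {b. ladder b}) =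
          (\<Sum>b\<in>{b}. indicator (prefix_set b) x * ?g b x)"
        by (intro nn_integral_count_space') (auto split: split_indicator dest: prefix_set_unique)
      with b show ?case by (simp add: record_step_overwrite)
    qed
  qed
  also have "\<dots> = (\<integral>\<^sup>+b. (\<integral>\<^sup>+x. indicator (prefix_set b) x * ?g b x \<partial>line_measure) \<partial>count_space {b. ladder b})"
    by (rule nn_integral_count_space_nn_integral) auto
  also have "\<dots> = (\<integral>\<^sup>+b. word_weight b * (\<integral>\<^sup>+x. f (overwrite (c @ b) x) \<partial>line_measure) \<partial>count_space {b. ladder b})"
    by (simp add: nn_integral_prefix)
  also have "\<dots> = (\<integral>\<^sup>+q. \<integral>\<^sup>+x. f (overwrite (c @ pass_block q) x) \<partial>line_measure \<partial>pass_measure)"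
    by (rule nn_integral_pass_block[symmetric])
  finally show ?thesis .
qed

end

section \<open>Coupling of record steps with passes\<close>

primrec blocks :: "(nat \<Rightarrow> pass_input) \<Rightarrow> nat \<Rightarrow> int list" where
  "blocks p 0 = []"
| "blocks p (Suc n) = pass_block (p n) @ blocks p n"

text \<open>A record step adds its word on the right, next to the root, whereas a pass adds its word
  on the left. Inserting the new input as the first pass reconciles the two orders.\<close>

lemma blocks_case_nat: "blocks (case_nat q p) (Suc n) = blocks p n @ pass_block q"
  by (induction n) auto

lemma length_blocks: "n \<le> length (blocks p n)"
  by (induction n) (auto simp: pass_block_def)

lemma run_pass_overwrite:
  assumes "pass_ok q"
  shows "run_pass q (-1 - int (length c), overwrite c y) =
    (-1 - int (length (pass_block q @ c)), overwrite (pass_block q @ c) y)"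
proof -
  obtain z0 k z where q: "q = ((z0, k), z)" by (metis prod.collapse)
  define t where "t = pass_time (z0 - 1) k z"
  have "t \<le> 0"
    using assms pass_time_props(1)[of _ "z0 - 1" z k] by (auto simp: pass_ok_def q t_def)
  then obtain s where s: "t = - int s" by (metis nonpos_int_cases)
  have block: "pass_block q = map z [- int s..-1] @ [z0 - 1]"
    by (simp add: pass_block_def q t_def[symmetric] s)
  have "(if i = -1 - int (length c) then z0 - 1
      else if -1 - int (length c) + t \<le> i \<and> i < -1 - int (length c) then z (i - (-1 - int (length c)))
      else overwrite c y i) = overwrite (pass_block q @ c) y i" for i
  proof -
    \<comment> \<open>\<open>j\<close> is the position in \<open>pass_block q @ c\<close> of the
      letter written at \<open>i\<close>.\<close>
    define j where "j = nat (i + 1 + int s + int (length c))"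
    consider "i < -1 - int (length c) - int s" | "-1 - int (length c) - int s \<le> i" "i < -1 - int (length c)"
      | "i = -1 - int (length c)" | "-1 - int (length c) < i" "i < 0" | "0 \<le> i"
      by linarith
    then show ?thesis
    proof cases
      case 2
      then have "j < s" "- int s + int j = i - (-1 - int (length c))" by (auto simp: j_def)
      with 2 show ?thesis by (auto simp: overwrite_def block s nth_append j_def add_ac intro!: arg_cong[where f = z])
    next
      case 3
      then show ?thesis by (auto simp: overwrite_def block s nth_append)
    next
      case 4
      then have "\<not> j < s" "j - s \<noteq> 0" "j - Suc s = nat (i + int (length c))" by (auto simp: j_def)
      moreover have "nat (i + int (length (pass_block q @ c))) = j" by (simp add: block j_def add_ac)
      ultimately show ?thesis using 4 by (auto simp: overwrite_def block nth_append)
    qed (auto simp: overwrite_def block s)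
  qed
  then have contents: "(\<lambda>i. if i = -1 - int (length c) then z0 - 1
      else if -1 - int (length c) + t \<le> i \<and> i < -1 - int (length c) then z (i - (-1 - int (length c)))
      else overwrite c y i) = overwrite (pass_block q @ c) y"
    by (rule ext)
  have "run_pass q (-1 - int (length c), overwrite c y) =
      (-1 - int (length c) + t - 1, overwrite (pass_block q @ c) y)"
    unfolding contents[symmetric] by (simp only: q run_pass.simps Let_def t_def)
  then show ?thesis by (simp add: block s)
qed

lemma run_passes_overwrite:
  assumes "\<And>j. pass_ok (p j)"
  shows "run_passes p y n = (-1 - int (length (blocks p n)), overwrite (blocks p n) y)"
proof (induction n)
  case 0
  then show ?case by simp
next
  case (Suc n)
  then show ?case using run_pass_overwrite[OF assms[of n], of "blocks p n" y] by simp
qed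

lemma overwrite_append: "- int (length c) \<le> i \<Longrightarrow> overwrite (b @ c) y i = overwrite c y i"
  by (auto simp: overwrite_def nth_append nat_add_distrib intro!: arg_cong[where f = "(!) c"])

lemma overwrite_blocks_stable:
  assumes "- int n \<le> i" "n \<le> m"
  shows "overwrite (blocks p m) y i = overwrite (blocks p n) y i"
  using assms(2)
proof (induction m rule: dec_induct)
  case base
  then show ?case ..
next
  case (step m)
  have "- int (length (blocks p m)) \<le> i" using length_blocks[of m p] step assms(1) by linarith
  with step show ?case by (simp add: overwrite_append)
qed

lemma overwrite_blocks_eq_constructed_seq:
  assumes "\<And>j. pass_ok (p j)" "- int n \<le> i"
  shows "overwrite (blocks p n) x i = constructed_seq (restrict x {0..}, p) i"
proof -
  have "overwrite (blocks p n) x i = overwrite (blocks p (nat (- i))) x i"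
    using assms(2) by (intro overwrite_blocks_stable) auto
  \<comment> \<open>For negative \<open>i\<close> the blocks already cover \<open>i\<close>, so the
    restriction changes only initial values that are no longer visible there.\<close>
  also have "\<dots> = overwrite (blocks p (nat (- i))) (restrict x {0..}) i"
    using length_blocks[of "nat (- i)" p] by (auto simp: overwrite_def)
  also have "\<dots> = constructed_seq (restrict x {0..}, p) i"
    by (simp add: constructed_seq_def run_passes_overwrite[OF assms(1)])
  finally show ?thesis .
qed

lemma tendsto_int_seqI:
  fixes f :: "'a \<Rightarrow> int \<Rightarrow> int"
  assumes "\<And>i. \<forall>\<^sub>F n in F. f n i = l i"
  shows "(f \<longlongrightarrow> l) F"
proof -
  have "((\<lambda>n. f n i) \<longlongrightarrow> l i) F" for i
    using assms[of i] by (rule tendsto_eventually)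
  then have "limitin (product_topology (\<lambda>_. euclidean) UNIV) f l F"
    by (simp add: limitin_componentwise)
  then show ?thesis by (simp add: euclidean_product_topology)
qed

text \<open>The current index and the pass time are random but take countably many values, so each
  may be frozen before measurability is checked.\<close>

lemma measurable_run_passes:
  assumes y: "\<And>i. (\<lambda>\<omega>. y \<omega> i) \<in> M \<rightarrow>\<^sub>M count_space UNIV"
    and zk [measurable]: "\<And>j. (\<lambda>\<omega>. fst (p \<omega> j)) \<in> M \<rightarrow>\<^sub>M count_space UNIV"
    and z [measurable]: "\<And>j m. (\<lambda>\<omega>. snd (p \<omega> j) m) \<in> M \<rightarrow>\<^sub>M count_space UNIV"
  shows "(\<lambda>\<omega>. fst (run_passes (p \<omega>) (y \<omega>) n)) \<in> M \<rightarrow>\<^sub>M count_space UNIV"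
    and "(\<lambda>\<omega>. snd (run_passes (p \<omega>) (y \<omega>) n) i) \<in> M \<rightarrow>\<^sub>M count_space UNIV"
proof (induction n arbitrary: i)
  case 0
  { case 1 show ?case by simp next case 2 show ?case using y by simp }
next
  case (Suc n)
  let ?l = "\<lambda>\<omega>. fst (run_passes (p \<omega>) (y \<omega>) n)"
  let ?yl = "\<lambda>\<omega>. fst (fst (p \<omega> n)) - 1"
  let ?t = "\<lambda>\<omega>. pass_time (?yl \<omega>) (snd (fst (p \<omega> n))) (snd (p \<omega> n))"
  have [measurable]: "?l \<in> M \<rightarrow>\<^sub>M count_space UNIV"
    "(\<lambda>\<omega>. snd (run_passes (p \<omega>) (y \<omega>) n) i) \<in> M \<rightarrow>\<^sub>M count_space UNIV" for i
    using Suc by auto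
  have [measurable]: "?yl \<in> M \<rightarrow>\<^sub>M count_space UNIV" "(\<lambda>\<omega>. snd (fst (p \<omega> n))) \<in> M \<rightarrow>\<^sub>M count_space UNIV"
    by (rule measurable_compose[OF zk], simp)+
  have [measurable]: "?t \<in> M \<rightarrow>\<^sub>M count_space UNIV" by measurable
  have fst_eq: "fst (run_pass q s) =
      fst s + pass_time (fst (fst q) - 1) (snd (fst q)) (snd q) - 1" for q s
    by (cases "(q, s)" rule: run_pass.cases) (simp add: Let_def)
  have snd_eq: "snd (run_pass q s) i = (if i = fst s then fst (fst q) - 1
      else if fst s + pass_time (fst (fst q) - 1) (snd (fst q)) (snd q) \<le> i \<and> i < fst s
      then snd q (i - fst s) else snd s i)" for q s i
    by (cases "(q, s)" rule: run_pass.cases) (simp add: Let_def)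
  {
    case 1
    have "(\<lambda>\<omega>. l + t - 1) \<in> M \<rightarrow>\<^sub>M count_space UNIV" for l t :: int
      by simp
    then have "(\<lambda>\<omega>. l + ?t \<omega> - 1) \<in> M \<rightarrow>\<^sub>M count_space UNIV" for l
      by (rule measurable_compose_countable[where g = ?t and f = "\<lambda>t \<omega>. l + t - 1"]) simp
    then have "(\<lambda>\<omega>. ?l \<omega> + ?t \<omega> - 1) \<in> M \<rightarrow>\<^sub>M count_space UNIV"
      by (rule measurable_compose_countable[where g = ?l and f = "\<lambda>l \<omega>. l + ?t \<omega> - 1"]) simp
    then show ?case by (simp only: run_passes.simps fst_eq)
  next
    case 2
    let ?c = "\<lambda>l t \<omega>. if i = l then ?yl \<omega> else if l + t \<le> i \<and> i < l
        then snd (p \<omega> n) (i - l) else snd (run_passes (p \<omega>) (y \<omega>) n) i"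
    have "?c l t \<in> M \<rightarrow>\<^sub>M count_space UNIV" for l t
      by measurable
    then have "(\<lambda>\<omega>. ?c l (?t \<omega>) \<omega>) \<in> M \<rightarrow>\<^sub>M count_space UNIV" for l
      by (rule measurable_compose_countable[where g = ?t and f = "?c l"]) simp
    then have "(\<lambda>\<omega>. ?c (?l \<omega>) (?t \<omega>) \<omega>) \<in> M \<rightarrow>\<^sub>M count_space UNIV"
      by (rule measurable_compose_countable[where g = ?l and f = "\<lambda>l \<omega>. ?c l (?t \<omega>) \<omega>"]) simp
    then show ?case by (simp only: run_passes.simps snd_eq)
  }
qed

section \<open>The coupling of the i.i.d. line with the sequence of passes, and the limit\<close>

context mean_zero_skip_free
begin

definition passes_measure :: "(nat \<Rightarrow> pass_input) measure" where
  "passes_measure = (\<Pi>\<^sub>M j\<in>UNIV. pass_measure)"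

sublocale passes: prob_space passes_measure
  unfolding passes_measure_def by (rule prob_space_PiM) (rule prob_space_pass_measure)

lemma measurable_blocks [measurable]: "(\<lambda>p. blocks p n) \<in> passes_measure \<rightarrow>\<^sub>M count_space UNIV"
proof (induction n)
  case (Suc n)
  note [measurable] = Suc
  have [measurable]: "(\<lambda>p. pass_block (p n)) \<in> passes_measure \<rightarrow>\<^sub>M count_space UNIV"
    unfolding passes_measure_def by measurable
  have "(\<lambda>p. pass_block (p n) @ blocks p n) \<in> passes_measure \<rightarrow>\<^sub>M count_space UNIV"
    by (rule measurable_compose_countable[of "\<lambda>b p. b @ blocks p n"],
        rule measurable_compose_countable[of _ _ _ "\<lambda>p. blocks p n"]) auto
  then show ?case by simp
qed simp

lemma passes_measure_peel:
  "distr (pass_measure \<Otimes>\<^sub>M passes_measure) passes_measure (\<lambda>(q, p). case_nat q p) = passes_measure"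
proof -
  interpret sequence_space pass_measure ..
  show ?thesis using PiM_iter unfolding passes_measure_def .
qed

lemma nn_integral_record_iterate:
  assumes "f \<in> borel_measurable borel"
  shows "(\<integral>\<^sup>+x. f ((record_step ^^ n) x) \<partial>line_measure) =
    (\<integral>\<^sup>+p. \<integral>\<^sup>+x. f (overwrite (blocks p n) x) \<partial>line_measure \<partial>passes_measure)"
  using assms
proof (induction n arbitrary: f)
  case 0
  then show ?case by (simp add: passes.emeasure_space_1)
next
  case (Suc n)
  note [measurable] = Suc.prems
  define h where "h c = (\<integral>\<^sup>+x. f (overwrite c x) \<partial>line_measure)" for c
  have h_count [measurable]: "h \<in> count_space UNIV \<rightarrow>\<^sub>M borel" by simp
  have peel [measurable]: "(\<lambda>(q, p). case_nat q p) \<in> pass_measure \<Otimes>\<^sub>M passes_measure \<rightarrow>\<^sub>M passes_measure"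
    unfolding passes_measure_def by measurable
  interpret pair: pair_sigma_finite pass_measure passes_measure ..
  have meas: "(\<lambda>p. h (blocks p (Suc n))) \<in> borel_measurable passes_measure"
    by (rule measurable_compose[OF measurable_blocks h_count])
  have "(\<integral>\<^sup>+x. f ((record_step ^^ Suc n) x) \<partial>line_measure) =
      (\<integral>\<^sup>+x. f (record_step ((record_step ^^ n) x)) \<partial>line_measure)"
    by simp
  \<comment> \<open>Applied to the composition of \<open>f\<close> with \<open>record_step\<close>,
    the induction hypothesis leaves one record step on a line that already carries \<open>n\<close>
    blocks.\<close>
  also have "\<dots> = (\<integral>\<^sup>+p. \<integral>\<^sup>+x. f (record_step (overwrite (blocks p n) x)) \<partial>line_measure \<partial>passes_measure)"
    by (rule Suc.IH[of "\<lambda>x. f (record_step x)"]) measurable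
  also have "\<dots> = (\<integral>\<^sup>+p. \<integral>\<^sup>+q. h (blocks (case_nat q p) (Suc n)) \<partial>pass_measure \<partial>passes_measure)"
    by (simp only: nn_integral_record_step[OF Suc.prems] blocks_case_nat h_def)
  also have "\<dots> = (\<integral>\<^sup>+w. h (blocks (case w of (q, p) \<Rightarrow> case_nat q p) (Suc n)) \<partial>(pass_measure \<Otimes>\<^sub>M passes_measure))"
    by (subst pair.nn_integral_snd[symmetric]) (use measurable_compose[OF peel meas] in auto)
  \<comment> \<open>Putting an independent input in front of an i.i.d. sequence of inputs does not
    change its law.\<close>
  also have "\<dots> = (\<integral>\<^sup>+p. h (blocks p (Suc n))
      \<partial>distr (pass_measure \<Otimes>\<^sub>M passes_measure) passes_measure (\<lambda>(q, p). case_nat q p))"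
    by (subst nn_integral_distr[OF peel]) (use meas in auto)
  finally show ?case by (simp only: passes_measure_peel h_def)
qed

definition coupling :: "((int \<Rightarrow> int) \<times> (nat \<Rightarrow> pass_input)) measure" where
  "coupling = line_measure \<Otimes>\<^sub>M passes_measure"

sublocale coupling: prob_space coupling
  unfolding coupling_def
  by (rule prob_space_pair) (rule line.prob_space_axioms passes.prob_space_axioms)+

lemma measurable_overwrite_blocks [measurable]:
  "(\<lambda>(x, p). overwrite (blocks p n) x) \<in> coupling \<rightarrow>\<^sub>M borel"
proof -
  have "(\<lambda>w. overwrite (blocks (snd w) n) (fst w)) \<in> coupling \<rightarrow>\<^sub>M borel"
    unfolding coupling_def
    by (rule measurable_overwrite)
       (auto intro: measurable_compose[OF measurable_snd] measurable_compose[OF measurable_fst])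
  then show ?thesis by (simp add: case_prod_beta')
qed

lemma distr_record_iterate:
  "distr line_measure borel (record_step ^^ n) = distr coupling borel (\<lambda>(x, p). overwrite (blocks p n) x)"
proof (rule measure_eqI)
  fix A assume "A \<in> sets (distr line_measure borel (record_step ^^ n))"
  then have A [measurable]: "A \<in> sets borel" by simp
  interpret pair: pair_sigma_finite line_measure passes_measure ..
  have step: "record_step ^^ n \<in> line_measure \<rightarrow>\<^sub>M borel" by measurable
  have "emeasure (distr line_measure borel (record_step ^^ n)) A =
      (\<integral>\<^sup>+x. indicator A x \<partial>distr line_measure borel (record_step ^^ n))"
    by simp
  also have "\<dots> = (\<integral>\<^sup>+x. indicator A ((record_step ^^ n) x) \<partial>line_measure)"
    by (rule nn_integral_distr[OF step]) measurable
  also have "\<dots> = (\<integral>\<^sup>+p. \<integral>\<^sup>+x. indicator A (overwrite (blocks p n) x) \<partial>line_measure \<partial>passes_measure)"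
    by (rule nn_integral_record_iterate) measurable
  also have "\<dots> = (\<integral>\<^sup>+w. indicator A (case w of (x, p) \<Rightarrow> overwrite (blocks p n) x) \<partial>coupling)"
  proof -
    have "(\<lambda>w. indicator A (case w of (x, p) \<Rightarrow> overwrite (blocks p n) x) :: ennreal) \<in> borel_measurable coupling"
      by measurable
    then show ?thesis
      unfolding coupling_def by (subst pair.nn_integral_snd[symmetric]) auto
  qed
  also have "\<dots> = (\<integral>\<^sup>+x. indicator A x \<partial>distr coupling borel (\<lambda>(x, p). overwrite (blocks p n) x))"
    by (rule nn_integral_distr[symmetric]) measurable
  also have "\<dots> = emeasure (distr coupling borel (\<lambda>(x, p). overwrite (blocks p n) x)) A"
    by simp
  finally show "emeasure (distr line_measure borel (record_step ^^ n)) A =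
      emeasure (distr coupling borel (\<lambda>(x, p). overwrite (blocks p n) x)) A" .
qed simp

lemma construction_space_eq:
  "construction_space lam = (\<Pi>\<^sub>M n\<in>{0..}. measure_pmf lam) \<Otimes>\<^sub>M passes_measure"
  by (simp add: construction_space_def passes_measure_def pass_measure_def past_measure_def)

lemma measurable_restrict_coupling:
  "(\<lambda>(x, p). (restrict x {0..}, p)) \<in> coupling \<rightarrow>\<^sub>M construction_space lam"
  unfolding coupling_def construction_space_eq line_measure_def by measurable

text \<open>The coupling carries a full line, since each finite stage still shows its left part. The
  limit sees only the nonnegative half, and forgetting the rest gives exactly the randomness of the
  construction.\<close>

lemma distr_restrict_coupling:
  "distr coupling (construction_space lam) (\<lambda>(x, p). (restrict x {0..}, p)) = construction_space lam"
proof -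
  let ?F = "\<Pi>\<^sub>M n\<in>{0::int..}. measure_pmf lam"
  have F: "distr line_measure ?F (\<lambda>x. restrict x {0..}) = ?F"
    using distr_PiM_reindex[of "UNIV :: int set" "\<lambda>_. measure_pmf lam" "\<lambda>i. i" "{0..}"]
    by (simp add: line_measure_def measure_pmf.prob_space_axioms restrict_def)
  have "(\<lambda>x. restrict x {0..}) \<in> line_measure \<rightarrow>\<^sub>M ?F"
    unfolding line_measure_def by (rule measurable_restrict_subset) simp
  then have "distr line_measure ?F (\<lambda>x. restrict x {0..}) \<Otimes>\<^sub>M distr passes_measure passes_measure (\<lambda>p. p) =
      distr coupling (construction_space lam) (\<lambda>(x, p). (restrict x {0..}, p))"
    unfolding coupling_def construction_space_eq
    by (intro pair_measure_distr) (auto simp: passes.sigma_finite_measure_axioms)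
  then show ?thesis by (simp add: F construction_space_eq)
qed

lemma measurable_constructed_seq: "constructed_seq \<in> construction_space lam \<rightarrow>\<^sub>M borel"
proof (rule measurable_int_seqI)
  fix i
  let ?C = "construction_space lam"
  have p: "(\<lambda>w. snd w j) \<in> ?C \<rightarrow>\<^sub>M measure_pmf (pass_pmf lam) \<Otimes>\<^sub>M (\<Pi>\<^sub>M n\<in>{..<0}. measure_pmf lam)" for j
    unfolding construction_space_def by measurable
  show "(\<lambda>w. constructed_seq w i) \<in> ?C \<rightarrow>\<^sub>M count_space UNIV"
    unfolding constructed_seq_def
  proof (rule measurable_run_passes(2))
    show "(\<lambda>w. fst w i) \<in> ?C \<rightarrow>\<^sub>M count_space UNIV" for i
      unfolding construction_space_def
      by (rule measurable_compose[OF measurable_fst measurable_PiM_pmf_component])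
    show "(\<lambda>w. fst (snd w j)) \<in> ?C \<rightarrow>\<^sub>M count_space UNIV" for j
      using measurable_compose[OF p measurable_fst, of j] by simp
    show "(\<lambda>w. snd (snd w j) m) \<in> ?C \<rightarrow>\<^sub>M count_space UNIV" for j m
      by (rule measurable_compose[OF measurable_compose[OF p measurable_snd] measurable_PiM_pmf_component])
  qed
qed

text \<open>Once all passes reach their levels, coordinate \<open>i\<close> is constant from stage
  \<open>nat (- i)\<close> on. Since \<open>int\<close> is discrete, this is convergence in the
  product topology.\<close>

lemma AE_overwrite_blocks_tendsto:
  "AE w in coupling. (\<lambda>n. case w of (x, p) \<Rightarrow> overwrite (blocks p n) x)
     \<longlonglongrightarrow> (case w of (x, p) \<Rightarrow> constructed_seq (restrict x {0..}, p))"
proof -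
  have "AE p in passes_measure. \<forall>j. pass_ok (p j)"
  proof (subst AE_all_countable, rule allI)
    fix j
    have "AE q in pass_measure. pass_ok q" using AE_pass by eventually_elim simp
    then show "AE p in passes_measure. pass_ok (p j)"
      unfolding passes_measure_def
      by (intro AE_PiM_component[where P = pass_ok]) (auto intro: prob_space_pass_measure)
  qed
  then have "AE w in coupling. \<forall>j. pass_ok (snd w j)"
    unfolding coupling_def by (rule AE_pair_snd[OF passes.sigma_finite_measure_axioms])
  then show ?thesis
  proof eventually_elim
    case (elim w)
    obtain x p where w: "w = (x, p)" by fastforce
    have "\<forall>\<^sub>F n in sequentially. overwrite (blocks p n) x i = constructed_seq (restrict x {0..}, p) i" for i
      using eventually_ge_at_top[of "nat (- i)"]
    proof eventually_elim
      case (elim n)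
      then show ?case
        using \<open>\<forall>j. pass_ok (snd w j)\<close> w
        by (intro overwrite_blocks_eq_constructed_seq) auto
    qed
    then show ?case unfolding w prod.case by (rule tendsto_int_seqI)
  qed
qed

lemma weakly_converges_record_iterate:
  "weakly_converges (\<lambda>n. distr line_measure borel (record_step ^^ n))
     (distr (construction_space lam) borel constructed_seq)"
  unfolding weakly_converges_def
proof (intro allI impI)
  fix f :: "(int \<Rightarrow> int) \<Rightarrow> real"
  assume cont: "continuous_on UNIV f" and "bounded (range f)"
  then obtain B where B: "\<And>x. norm (f x) \<le> B" by (auto simp: bounded_iff)
  note [measurable] = borel_measurable_continuous_onI[OF cont]
  note [measurable] = measurable_constructed_seq measurable_restrict_coupling
  have limit: "(\<integral>x. f x \<partial>distr (construction_space lam) borel constructed_seq) =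
      (\<integral>w. f (case w of (x, p) \<Rightarrow> constructed_seq (restrict x {0..}, p)) \<partial>coupling)"
  proof -
    have "(\<integral>x. f x \<partial>distr (construction_space lam) borel constructed_seq) =
        (\<integral>w. f (constructed_seq w) \<partial>construction_space lam)"
      by (rule integral_distr) measurable
    also have "\<dots> = (\<integral>w. f (constructed_seq w)
        \<partial>distr coupling (construction_space lam) (\<lambda>(x, p). (restrict x {0..}, p)))"
      by (simp only: distr_restrict_coupling)
    also have "\<dots> = (\<integral>w. f (constructed_seq (case w of (x, p) \<Rightarrow> (restrict x {0..}, p))) \<partial>coupling)"
      by (rule integral_distr) measurable
    finally show ?thesis by (simp add: case_prod_beta')
  qed
  have approx: "(\<integral>x. f x \<partial>distr line_measure borel (record_step ^^ n)) =
      (\<integral>w. f (case w of (x, p) \<Rightarrow> overwrite (blocks p n) x) \<partial>coupling)" for n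
    unfolding distr_record_iterate by (rule integral_distr) measurable
  have meas_limit: "(\<lambda>w. f (case w of (x, p) \<Rightarrow> constructed_seq (restrict x {0..}, p))) \<in> borel_measurable coupling"
  proof -
    have "(\<lambda>w. f (constructed_seq (case w of (x, p) \<Rightarrow> (restrict x {0..}, p)))) \<in> borel_measurable coupling"
      by measurable
    then show ?thesis by (simp add: case_prod_beta')
  qed
  show "(\<lambda>n. \<integral>x. f x \<partial>distr line_measure borel (record_step ^^ n))
      \<longlonglongrightarrow> (\<integral>x. f x \<partial>distr (construction_space lam) borel constructed_seq)"
    unfolding limit approx
  proof (rule integral_dominated_convergence[where w = "\<lambda>_. B"])
    show "AE w in coupling. (\<lambda>n. f (case w of (x, p) \<Rightarrow> overwrite (blocks p n) x))
        \<longlonglongrightarrow> f (case w of (x, p) \<Rightarrow> constructed_seq (restrict x {0..}, p))"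
      using AE_overwrite_blocks_tendsto
    proof eventually_elim
      case (elim w)
      show ?case by (rule continuous_on_tendsto_compose[OF cont elim]) auto
    qed
  qed (use B meas_limit in \<open>auto\<close>)
qed

end

section \<open>Transfer from the increments \<open>X\<close> to their product law\<close>

theorem proposition104:
  fixes M :: "'a measure" and X :: "int \<Rightarrow> 'a \<Rightarrow> int" and lam :: "int pmf"
  assumes "skip_free_left_increments M X"
    and "(\<integral>\<omega>. real_of_int (X 0 \<omega>) \<partial>M) = 0"
    and "distr M (count_space UNIV) (X 0) = measure_pmf lam"
  shows "is_vertex_shift_probability record_map M (\<lambda>\<omega> n. X n \<omega>)
    (distr (construction_space lam) borel (\<lambda>\<omega>. rooted_line 0 (constructed_seq \<omega>)))"
proof -
  interpret M: prob_space M using assms(1) by (simp add: skip_free_left_increments_def)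
  have indep: "M.indep_vars (\<lambda>_. count_space UNIV) X UNIV"
    and ident: "distr M (count_space UNIV) (X n) = measure_pmf lam"
    and ge: "AE \<omega> in M. X n \<omega> \<ge> -1"
    and pos: "measure M {\<omega> \<in> space M. X 0 \<omega> = -1} > 0"
    and int: "integrable M (\<lambda>\<omega>. real_of_int (X 0 \<omega>))" for n
    using assms(1,3) by (auto simp: skip_free_left_increments_def)
  have X [measurable]: "X n \<in> M \<rightarrow>\<^sub>M count_space UNIV" for n
    using indep by (auto simp: M.indep_vars_def)
  interpret mean_zero_skip_free lam
  proof
    have "AE x in distr M (count_space UNIV) (X 0). -1 \<le> x"
      using ge[of 0] by (subst AE_distr_iff) auto
    then show "-1 \<le> x" if "x \<in> set_pmf lam" for x
      using that unfolding assms(3) by (simp add: AE_measure_pmf_iff)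
    have "measure (distr M (count_space UNIV) (X 0)) {-1} = measure M {\<omega> \<in> space M. X 0 \<omega> = -1}"
      by (subst measure_distr) (auto simp: vimage_def Int_def conj_commute)
    then have "0 < pmf lam (-1)"
      using pos by (simp add: assms(3) measure_pmf_single)
    then show "-1 \<in> set_pmf lam" by (simp add: set_pmf_iff)
    show "integrable (measure_pmf lam) real_of_int"
      unfolding assms(3)[symmetric] using int by (subst integrable_distr_eq) auto
    show "(\<integral>x. real_of_int x \<partial>measure_pmf lam) = 0"
      unfolding assms(3)[symmetric] using assms(2) by (subst integral_distr) auto
  qed
  have seq [measurable]: "(\<lambda>\<omega> n. X n \<omega>) \<in> M \<rightarrow>\<^sub>M borel"
    by (rule measurable_int_seqI) simp
  have "distr M (\<Pi>\<^sub>M n\<in>UNIV. count_space UNIV) (\<lambda>\<omega> n. X n \<omega>) = line_measure"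
    using M.indep_vars_iff_distr_eq_PiM'[THEN iffD1, OF _ _ indep]
    by (simp add: ident line_measure_def restrict_UNIV)
  \<comment> \<open>Only the target sigma-algebra changes: on integer sequences the product of the
    discrete ones consists of the Borel sets.\<close>
  moreover have "distr M (\<Pi>\<^sub>M n\<in>UNIV. count_space UNIV) (\<lambda>\<omega> n. X n \<omega>) = distr M borel (\<lambda>\<omega> n. X n \<omega>)"
  proof (rule distr_cong)
    show "sets (\<Pi>\<^sub>M n\<in>(UNIV :: int set). count_space (UNIV :: int set)) = sets borel"
      using sets_line_measure unfolding line_measure_def
      by (subst (asm) sets_PiM_cong[OF refl, where N = "\<lambda>_. count_space UNIV"]) auto
  qed auto
  ultimately have law: "distr M borel (\<lambda>\<omega> n. X n \<omega>) = line_measure" by simp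
  have "distr M borel (\<lambda>\<omega>. rooted_line ((record_map (\<lambda>n. X n \<omega>) ^^ n) 0) (\<lambda>n. X n \<omega>)) =
      distr line_measure borel (record_step ^^ n)" for n
    unfolding rooted_line_record_iterate law[symmetric]
    by (subst distr_distr) (auto simp: comp_def)
  moreover have "(\<lambda>\<omega>. rooted_line 0 (constructed_seq \<omega>)) = constructed_seq"
    by (simp add: rooted_line_def)
  ultimately show ?thesis
    unfolding is_vertex_shift_probability_def using weakly_converges_record_iterate by simp
qed

end
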